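(* Let $\mathcal{C}$ be an atomically complete category and $\mathcal{C}\hookrightarrow\mathcal{D}$ a full embedding of $\mathcal{C}$ into a category $\mathcal{D}$ containing a $\mathcal{C}$-universal and $\mathcal{C}$-ultrahomogeneous object $u$. For an arrow $\chi:d\to u$ in $\mathcal{D}$ with $d\in\mathcal{C}$ let $\mathcal{I}_{\chi}:=\{f:u\cong u\mid f\circ\chi=\chi\}$; suppose that these subgroups form an algebraic base for $Aut_{\mathcal{D}}(u)$, endow $Aut_{\mathcal{D}}(u)$ with the resulting topology, and suppose that the functor $\mathcal{C}^{\mathrm{op}}\to\mathbf{Cont}(Aut_{\mathcal{D}}(u))$, $c\mapsto\mathrm{Hom}_{\mathcal{D}}(c,u)$, $f\mapsto -\circ f$, induces an equivalence $$\mathbf{Sh}(\mathcal{C}^{\mathrm{op}},J_{at})\simeq\mathbf{Cont}(Aut_{\mathcal{D}}(u)).$$ Let $F:(\mathcal{C}/u)^{\mathrm{op}}\to Subgr(Aut_{\mathcal{D}}(u))$ be the functor sending any object $\chi:d\to u$ of $\mathcal{C}/u$ to the subgroup $\mathcal{I}_{\chi}$. Then $F$ induces a bijection between the isomorphism classes of objects of $\mathcal{C}/u$ and the open subgroups of $Aut_{\mathcal{D}}(u)$. For any open subgroup $U$ of $Aut_{\mathcal{D}}(u)$ the arrow $\chi_U:c_U\to u$ in $\mathcal{D}$ corresponding to it under this bijection satisfies the following universal property: it is fixed by all the automorphisms in $U$, and any other arrow $a\to u$ in $\mathcal{D}$ (with $a\in\mathcal{C}$) which is fixed by all the automorphisms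 in $U$ factors uniquely through it.
   Context: A small category $\mathcal{C}$ is atomically complete if (1) it satisfies the amalgamation property (for all $f:a\to b$, $g:a\to c$ there are $f':b\to d$, $g':c\to d$ with $f'\circ f=g'\circ g$), (2) the atomic topology $J_{at}$ on $\mathcal{C}^{\mathrm{op}}$ (covering sieves are exactly the non-empty ones) is subcanonical, and (3) every atom (non-zero object with no proper non-zero subobjects) of $\mathbf{Sh}(\mathcal{C}^{\mathrm{op}},J_{at})$ is, up to isomorphism, of the form $l(c)$ for some $c\in\mathcal{C}$, where $l$ is the Yoneda embedding $\mathcal{C}^{\mathrm{op}}\to[\mathcal{C},\mathbf{Set}]$ followed by sheafification. An object $u$ of $\mathcal{D}$ is $\mathcal{C}$-universal if every $a\in\mathcal{C}$ admits an arrow $a\to u$ in $\mathcal{D}$; it is $\mathcal{C}$-ultrahomogeneous if for every $j:a\to b$ in $\mathcal{C}$ and $\chi_1:a\to u$, $\chi_2:b\to u$ in $\mathcal{D}$ there is an automorphism $\check{j}$ of $u$ with $\check{j}\circ\chi_1=\chi_2\circ j$. $\mathcal{C}/u$ is the category whose objects are the arrows $\chi:d\to u$ in $\mathcal{D}$ with $d\in\mathcal{C}$ and whose arrows are the commutative triangles over $u$ given by arrows of $\mathcal{C}$. $Aut_{\mathcal{D}}(u)$ is the group of automorphisms of $u$ in $\mathcal{D}$, and $Subgr(Aut_{\mathcal{D}}(u))$ is the preorder category of its subgroups ordered by inclusion. An algebraic base for a group is a (non-empty) collection of subgroups such that the intersection of any two members contains a member and every conjugate of a member is a member; it is a neighbourhood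 basis of the identity for a unique group topology. $\mathbf{Cont}(G)$ is the topos of continuous actions of a topological group $G$ on discrete sets. An arrow $\chi:a\to u$ is fixed by an automorphism $f$ of $u$ if $f\circ\chi=\chi$. *)

theory Defs
  imports
    "HOL-Algebra.Group_Action"
    "HOL-Analysis.Product_Topology"
    "HOL-Library.Equipollence"
begin

section \<open>Categories, functors, natural transformations\<close>

text \<open>
  Hom-sets are not required to be disjoint, so composition is indexed by the three objects:
  \<open>Comp C a b c g f\<close> is \<open>g \<circ> f\<close> for \<open>f : a \<rightarrow> b\<close> and \<open>g : b \<rightarrow> c\<close>.  All hom-sets of a
  \<open>('o, 'm) cat\<close> are subsets of \<open>'m\<close>.  Throughout, the subsets of \<open>'m\<close> play the role of the
  small sets (\<open>Set\<close> is \<open>set_cat\<close> below), so such a category is locally small by construction;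
  \<open>'m\<close> is an arbitrary type and can be taken as large as desired.
\<close>

record ('o, 'm) cat =
  Ob :: "'o set"
  Hom :: "'o \<Rightarrow> 'o \<Rightarrow> 'm set"
  Ident :: "'o \<Rightarrow> 'm"
  Comp :: "'o \<Rightarrow> 'o \<Rightarrow> 'o \<Rightarrow> 'm \<Rightarrow> 'm \<Rightarrow> 'm"

definition category :: "('o, 'm) cat \<Rightarrow> bool" where
  "category C \<longleftrightarrow>
     (\<forall>a\<in>Ob C. Ident C a \<in> Hom C a a) \<and>
     (\<forall>a\<in>Ob C. \<forall>b\<in>Ob C. \<forall>c\<in>Ob C. \<forall>f\<in>Hom C a b. \<forall>g\<in>Hom C b c. Comp C a b c g f \<in> Hom C a c) \<and>
     (\<forall>a\<in>Ob C. \<forall>b\<in>Ob C. \<forall>f\<in>Hom C a b.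
        Comp C a b b (Ident C b) f = f \<and> Comp C a a b f (Ident C a) = f) \<and>
     (\<forall>a\<in>Ob C. \<forall>b\<in>Ob C. \<forall>c\<in>Ob C. \<forall>d\<in>Ob C.
        \<forall>f\<in>Hom C a b. \<forall>g\<in>Hom C b c. \<forall>h\<in>Hom C c d.
        Comp C a c d h (Comp C a b c g f) = Comp C a b d (Comp C b c d h g) f)"

text \<open>Small: the set of objects is also in bijection with a subset of \<open>'m\<close>.\<close>

definition small_category :: "('o, 'm) cat \<Rightarrow> bool" where
  "small_category C \<longleftrightarrow> category C \<and> Ob C \<lesssim> (UNIV :: 'm set)"

definition op_cat :: "('o, 'm) cat \<Rightarrow> ('o, 'm) cat" where
  "op_cat C = \<lparr>Ob = Ob C, Hom = (\<lambda>a b. Hom C b a), Ident = Ident C,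
     Comp = (\<lambda>a b c g f. Comp C c b a f g)\<rparr>"

definition full_subcat :: "('o, 'm) cat \<Rightarrow> 'o set \<Rightarrow> ('o, 'm) cat" where
  "full_subcat C S = C\<lparr>Ob := Ob C \<inter> S\<rparr>"

definition iso_in :: "('o, 'm) cat \<Rightarrow> 'o \<Rightarrow> 'o \<Rightarrow> 'm \<Rightarrow> bool" where
  "iso_in C a b f \<longleftrightarrow> f \<in> Hom C a b \<and>
     (\<exists>g\<in>Hom C b a. Comp C a b a g f = Ident C a \<and> Comp C b a b f g = Ident C b)"

definition isomorphic_in :: "('o, 'm) cat \<Rightarrow> 'o \<Rightarrow> 'o \<Rightarrow> bool" where
  "isomorphic_in C a b \<longleftrightarrow> a \<in> Ob C \<and> b \<in> Ob C \<and> (\<exists>f. iso_in C a b f)"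

definition iso_rel :: "('o, 'm) cat \<Rightarrow> ('o \<times> 'o) set" where
  "iso_rel C = {(a, b). isomorphic_in C a b}"

definition mono_in :: "('o, 'm) cat \<Rightarrow> 'o \<Rightarrow> 'o \<Rightarrow> 'm \<Rightarrow> bool" where
  "mono_in C a b f \<longleftrightarrow> f \<in> Hom C a b \<and>
     (\<forall>x\<in>Ob C. \<forall>g\<in>Hom C x a. \<forall>h\<in>Hom C x a. Comp C x a b f g = Comp C x a b f h \<longrightarrow> g = h)"

definition initial_in :: "('o, 'm) cat \<Rightarrow> 'o \<Rightarrow> bool" where
  "initial_in C z \<longleftrightarrow> z \<in> Ob C \<and> (\<forall>a\<in>Ob C. \<exists>!f. f \<in> Hom C z a)"

text \<open>The zero object of a topos is its initial object.\<close>

definition atom_in :: "('o, 'm) cat \<Rightarrow> 'o \<Rightarrow> bool" where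
  "atom_in C a \<longleftrightarrow> a \<in> Ob C \<and> \<not> initial_in C a \<and>
     (\<forall>b\<in>Ob C. \<forall>m. mono_in C b a m \<longrightarrow> initial_in C b \<or> iso_in C b a m)"

text \<open>\<open>far F a b f\<close> is the image of \<open>f : a \<rightarrow> b\<close>.\<close>

record ('o, 'm, 'p, 'n) cfunctor =
  fob :: "'o \<Rightarrow> 'p"
  far :: "'o \<Rightarrow> 'o \<Rightarrow> 'm \<Rightarrow> 'n"

definition is_functor ::
  "('o, 'm) cat \<Rightarrow> ('p, 'n) cat \<Rightarrow> ('o, 'm, 'p, 'n) cfunctor \<Rightarrow> bool" where
  "is_functor C D F \<longleftrightarrow>
     (\<forall>a\<in>Ob C. fob F a \<in> Ob D) \<and>
     (\<forall>a\<in>Ob C. \<forall>b\<in>Ob C. \<forall>f\<in>Hom C a b. far F a b f \<in> Hom D (fob F a) (fob F b)) \<and>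
     (\<forall>a\<in>Ob C. far F a a (Ident C a) = Ident D (fob F a)) \<and>
     (\<forall>a\<in>Ob C. \<forall>b\<in>Ob C. \<forall>c\<in>Ob C. \<forall>f\<in>Hom C a b. \<forall>g\<in>Hom C b c.
        far F a c (Comp C a b c g f) =
        Comp D (fob F a) (fob F b) (fob F c) (far F b c g) (far F a b f))"

definition id_functor :: "('o, 'm, 'o, 'm) cfunctor" where
  "id_functor = \<lparr>fob = (\<lambda>a. a), far = (\<lambda>a b f. f)\<rparr>"

definition comp_functor ::
  "('p, 'n, 'q, 'k) cfunctor \<Rightarrow> ('o, 'm, 'p, 'n) cfunctor \<Rightarrow> ('o, 'm, 'q, 'k) cfunctor" where
  "comp_functor G F =
     \<lparr>fob = (\<lambda>a. fob G (fob F a)), far = (\<lambda>a b f. far G (fob F a) (fob F b) (far F a b f))\<rparr>"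

text \<open>
  Natural transformations are extensional functions on \<open>Ob C\<close>, so that equality in the hom-sets
  is equality of all components.  The functors themselves are not normalised outside \<open>C\<close>;
  functors which agree on \<open>C\<close> are isomorphic.
\<close>

definition functor_cat ::
  "('o, 'm) cat \<Rightarrow> ('p, 'n) cat \<Rightarrow> (('o, 'm, 'p, 'n) cfunctor, 'o \<Rightarrow> 'n) cat" where
  "functor_cat C D =
     \<lparr>Ob = {F. is_functor C D F},
      Hom = (\<lambda>F G. {\<tau> \<in> (\<Pi>\<^sub>E a\<in>Ob C. Hom D (fob F a) (fob G a)).
               \<forall>a\<in>Ob C. \<forall>b\<in>Ob C. \<forall>f\<in>Hom C a b.
                 Comp D (fob F a) (fob F b) (fob G b) (\<tau> b) (far F a b f) =
                 Comp D (fob F a) (fob G a) (fob G b) (far G a b f) (\<tau> a)}),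
      Ident = (\<lambda>F. \<lambda>a\<in>Ob C. Ident D (fob F a)),
      Comp = (\<lambda>F G H \<tau> \<sigma>. \<lambda>a\<in>Ob C. Comp D (fob F a) (fob G a) (fob H a) (\<tau> a) (\<sigma> a))\<rparr>"

definition equivalence ::
  "('o, 'm) cat \<Rightarrow> ('p, 'n) cat \<Rightarrow> ('o, 'm, 'p, 'n) cfunctor \<Rightarrow> bool" where
  "equivalence C D \<Phi> \<longleftrightarrow> is_functor C D \<Phi> \<and>
     (\<exists>\<Psi>. is_functor D C \<Psi> \<and>
        isomorphic_in (functor_cat C C) (comp_functor \<Psi> \<Phi>) id_functor \<and>
        isomorphic_in (functor_cat D D) (comp_functor \<Phi> \<Psi>) id_functor)"

text \<open>Fully faithful functors; injectivity on objects is not required.\<close>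

definition full_embedding ::
  "('o, 'm) cat \<Rightarrow> ('p, 'n) cat \<Rightarrow> ('o, 'm, 'p, 'n) cfunctor \<Rightarrow> bool" where
  "full_embedding C D \<iota> \<longleftrightarrow> is_functor C D \<iota> \<and>
     (\<forall>a\<in>Ob C. \<forall>b\<in>Ob C. bij_betw (far \<iota> a b) (Hom C a b) (Hom D (fob \<iota> a) (fob \<iota> b)))"

definition set_cat :: "('v set, 'v \<Rightarrow> 'v) cat" where
  "set_cat =
     \<lparr>Ob = UNIV, Hom = (\<lambda>A B. A \<rightarrow>\<^sub>E B), Ident = (\<lambda>A. \<lambda>x\<in>A. x),
      Comp = (\<lambda>A B C g f. compose A g f)\<rparr>"


section \<open>Presheaves and sheaves\<close>

type_synonym ('o, 'm) presheaf = "('o, 'm, 'm set, 'm \<Rightarrow> 'm) cfunctor"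

definition psh_cat :: "('o, 'm) cat \<Rightarrow> (('o, 'm) presheaf, 'o \<Rightarrow> 'm \<Rightarrow> 'm) cat" where
  "psh_cat K = functor_cat (op_cat K) set_cat"

definition yoneda ::
  "('o, 'm) cat \<Rightarrow> ('o, 'm, ('o, 'm) presheaf, 'o \<Rightarrow> 'm \<Rightarrow> 'm) cfunctor" where
  "yoneda K =
     \<lparr>fob = (\<lambda>c. \<lparr>fob = (\<lambda>d. Hom K d c),
                 far = (\<lambda>d e g. \<lambda>f\<in>Hom K d c. Comp K e d c f g)\<rparr>),
      far = (\<lambda>c c' h. \<lambda>d\<in>Ob K. \<lambda>f\<in>Hom K d c. Comp K d c c' h f)\<rparr>"

text \<open>A sieve on \<open>c\<close> is a set of pairs \<open>(d, f)\<close> with \<open>f : d \<rightarrow> c\<close>.\<close>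

definition is_sieve :: "('o, 'm) cat \<Rightarrow> 'o \<Rightarrow> ('o \<times> 'm) set \<Rightarrow> bool" where
  "is_sieve K c S \<longleftrightarrow> S \<subseteq> (SIGMA d:Ob K. Hom K d c) \<and>
     (\<forall>(d, f)\<in>S. \<forall>e\<in>Ob K. \<forall>g\<in>Hom K e d. (e, Comp K e d c f g) \<in> S)"

definition atomic_topology :: "('o, 'm) cat \<Rightarrow> 'o \<Rightarrow> ('o \<times> 'm) set set" where
  "atomic_topology K c = {S. is_sieve K c S \<and> S \<noteq> {}}"

definition matching_family ::
  "('o, 'm) cat \<Rightarrow> ('o, 'm) presheaf \<Rightarrow> 'o \<Rightarrow> ('o \<times> 'm) set \<Rightarrow> ('o \<Rightarrow> 'm \<Rightarrow> 'm) \<Rightarrow> bool" where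
  "matching_family K P c S x \<longleftrightarrow>
     (\<forall>(d, f)\<in>S. x d f \<in> fob P d) \<and>
     (\<forall>(d, f)\<in>S. \<forall>e\<in>Ob K. \<forall>g\<in>Hom K e d. far P d e g (x d f) = x e (Comp K e d c f g))"

definition is_sheaf ::
  "('o, 'm) cat \<Rightarrow> ('o \<Rightarrow> ('o \<times> 'm) set set) \<Rightarrow> ('o, 'm) presheaf \<Rightarrow> bool" where
  "is_sheaf K J P \<longleftrightarrow> P \<in> Ob (psh_cat K) \<and>
     (\<forall>c\<in>Ob K. \<forall>S\<in>J c. \<forall>x. matching_family K P c S x \<longrightarrow>
        (\<exists>!s. s \<in> fob P c \<and> (\<forall>(d, f)\<in>S. far P c d f s = x d f)))"

definition sh_cat ::
  "('o, 'm) cat \<Rightarrow> ('o \<Rightarrow> ('o \<times> 'm) set set) \<Rightarrow> (('o, 'm) presheaf, 'o \<Rightarrow> 'm \<Rightarrow> 'm) cat" where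
  "sh_cat K J = full_subcat (psh_cat K) {P. is_sheaf K J P}"

definition subcanonical :: "('o, 'm) cat \<Rightarrow> ('o \<Rightarrow> ('o \<times> 'm) set set) \<Rightarrow> bool" where
  "subcanonical K J \<longleftrightarrow> (\<forall>c\<in>Ob K. is_sheaf K J (fob (yoneda K) c))"

text \<open>\<open>\<eta> : P \<rightarrow> S\<close> exhibits \<open>S\<close> as the associated sheaf of \<open>P\<close>.\<close>

definition sheafification ::
  "('o, 'm) cat \<Rightarrow> ('o \<Rightarrow> ('o \<times> 'm) set set) \<Rightarrow> ('o, 'm) presheaf \<Rightarrow> ('o, 'm) presheaf
     \<Rightarrow> ('o \<Rightarrow> 'm \<Rightarrow> 'm) \<Rightarrow> bool" where
  "sheafification K J P S \<eta> \<longleftrightarrow>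
     S \<in> Ob (sh_cat K J) \<and> \<eta> \<in> Hom (psh_cat K) P S \<and>
     (\<forall>Q\<in>Ob (sh_cat K J). \<forall>\<tau>\<in>Hom (psh_cat K) P Q.
        \<exists>!\<sigma>. \<sigma> \<in> Hom (sh_cat K J) S Q \<and> Comp (psh_cat K) P S Q \<sigma> \<eta> = \<tau>)"

text \<open>
  \<open>l : K \<rightarrow> Sh(K, J)\<close> is the Yoneda embedding followed by sheafification.  As sheafification is
  given by its universal property, this determines \<open>l\<close> up to (unique compatible) isomorphism of
  functors, and it is immaterial whether such an \<open>l\<close> is quantified existentially or universally
  below.
\<close>

definition sheafified_yoneda ::
  "('o, 'm) cat \<Rightarrow> ('o \<Rightarrow> ('o \<times> 'm) set set)
     \<Rightarrow> ('o, 'm, ('o, 'm) presheaf, 'o \<Rightarrow> 'm \<Rightarrow> 'm) cfunctor \<Rightarrow> bool" where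
  "sheafified_yoneda K J l \<longleftrightarrow> is_functor K (sh_cat K J) l \<and>
     (\<exists>\<eta>\<in>Hom (functor_cat K (psh_cat K)) (yoneda K) l.
        \<forall>c\<in>Ob K. sheafification K J (fob (yoneda K) c) (fob l c) (\<eta> c))"

text \<open>
  \<open>A : K \<rightarrow> E\<close> induces an equivalence \<open>Sh(K, J) \<simeq> E\<close> if some equivalence \<open>\<Phi>\<close> extends \<open>A\<close>
  along \<open>l\<close>, i.e. \<open>\<Phi> \<circ> l \<cong> A\<close>.
\<close>

definition induces_equivalence ::
  "('o, 'm) cat \<Rightarrow> ('o \<Rightarrow> ('o \<times> 'm) set set) \<Rightarrow> ('p, 'n) cat
     \<Rightarrow> ('o, 'm, 'p, 'n) cfunctor \<Rightarrow> bool" where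
  "induces_equivalence K J E A \<longleftrightarrow> is_functor K E A \<and>
     (\<exists>l \<Phi>. sheafified_yoneda K J l \<and> equivalence (sh_cat K J) E \<Phi> \<and>
        isomorphic_in (functor_cat K E) (comp_functor \<Phi> l) A)"


section \<open>Atomically complete categories\<close>

definition amalgamation_property :: "('o, 'm) cat \<Rightarrow> bool" where
  "amalgamation_property C \<longleftrightarrow>
     (\<forall>a\<in>Ob C. \<forall>b\<in>Ob C. \<forall>c\<in>Ob C. \<forall>f\<in>Hom C a b. \<forall>g\<in>Hom C a c.
        \<exists>d\<in>Ob C. \<exists>f'\<in>Hom C b d. \<exists>g'\<in>Hom C c d. Comp C a b d f' f = Comp C a c d g' g)"

definition atomically_complete :: "('o, 'm) cat \<Rightarrow> bool" where
  "atomically_complete C \<longleftrightarrow>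
     small_category C \<and>
     amalgamation_property C \<and>
     subcanonical (op_cat C) (atomic_topology (op_cat C)) \<and>
     (\<exists>l. sheafified_yoneda (op_cat C) (atomic_topology (op_cat C)) l \<and>
        (\<forall>A. atom_in (sh_cat (op_cat C) (atomic_topology (op_cat C))) A \<longrightarrow>
           (\<exists>c\<in>Ob C.
              isomorphic_in (sh_cat (op_cat C) (atomic_topology (op_cat C))) A (fob l c))))"


section \<open>Automorphism groups, universality and ultrahomogeneity\<close>

definition aut_group :: "('p, 'v) cat \<Rightarrow> 'p \<Rightarrow> 'v monoid" where
  "aut_group D u = \<lparr>carrier = {f. iso_in D u u f}, mult = Comp D u u u, one = Ident D u\<rparr>"

definition fixing_subgroup :: "('p, 'v) cat \<Rightarrow> 'p \<Rightarrow> 'p \<Rightarrow> 'v \<Rightarrow> 'v set" where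
  "fixing_subgroup D u d \<chi> = {f \<in> carrier (aut_group D u). Comp D d u u f \<chi> = \<chi>}"

definition universal_for ::
  "('o, 'm) cat \<Rightarrow> ('p, 'v) cat \<Rightarrow> ('o, 'm, 'p, 'v) cfunctor \<Rightarrow> 'p \<Rightarrow> bool" where
  "universal_for C D \<iota> u \<longleftrightarrow> u \<in> Ob D \<and> (\<forall>a\<in>Ob C. Hom D (fob \<iota> a) u \<noteq> {})"

definition ultrahomogeneous_for ::
  "('o, 'm) cat \<Rightarrow> ('p, 'v) cat \<Rightarrow> ('o, 'm, 'p, 'v) cfunctor \<Rightarrow> 'p \<Rightarrow> bool" where
  "ultrahomogeneous_for C D \<iota> u \<longleftrightarrow> u \<in> Ob D \<and>
     (\<forall>a\<in>Ob C. \<forall>b\<in>Ob C. \<forall>j\<in>Hom C a b. \<forall>\<chi>1\<in>Hom D (fob \<iota> a) u. \<forall>\<chi>2\<in>Hom D (fob \<iota> b) u.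
        \<exists>k\<in>carrier (aut_group D u).
          Comp D (fob \<iota> a) u u k \<chi>1 = Comp D (fob \<iota> a) (fob \<iota> b) u \<chi>2 (far \<iota> a b j))"

definition slice_cat ::
  "('o, 'm) cat \<Rightarrow> ('p, 'v) cat \<Rightarrow> ('o, 'm, 'p, 'v) cfunctor \<Rightarrow> 'p \<Rightarrow> ('o \<times> 'v, 'm) cat" where
  "slice_cat C D \<iota> u =
     \<lparr>Ob = (SIGMA d:Ob C. Hom D (fob \<iota> d) u),
      Hom = (\<lambda>(d, \<chi>) (e, \<xi>). {f \<in> Hom C d e. Comp D (fob \<iota> d) (fob \<iota> e) u \<xi> (far \<iota> d e f) = \<chi>}),
      Ident = (\<lambda>(d, \<chi>). Ident C d),
      Comp = (\<lambda>(d, \<chi>) (e, \<xi>) (k, \<zeta>) g f. Comp C d e k g f)\<rparr>"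

definition subgroup_cat :: "('g, 'b) monoid_scheme \<Rightarrow> ('g set, unit) cat" where
  "subgroup_cat G =
     \<lparr>Ob = {H. subgroup H G}, Hom = (\<lambda>H K. if H \<subseteq> K then {()} else {}),
      Ident = (\<lambda>H. ()), Comp = (\<lambda>H K L g f. ())\<rparr>"

text \<open>The functor \<open>F : (C/u)\<^sup>o\<^sup>p \<rightarrow> Subgr(Aut(u))\<close>.\<close>

definition fixing_functor ::
  "('p, 'v) cat \<Rightarrow> ('o, 'm, 'p, 'v) cfunctor \<Rightarrow> 'p \<Rightarrow> ('o \<times> 'v, 'm, 'v set, unit) cfunctor" where
  "fixing_functor D \<iota> u =
     \<lparr>fob = (\<lambda>(d, \<chi>). fixing_subgroup D u (fob \<iota> d) \<chi>), far = (\<lambda>p q f. ())\<rparr>"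

text \<open>The map on isomorphism classes induced by an isomorphism-invariant map on objects.\<close>

definition on_classes :: "('o \<Rightarrow> 'b) \<Rightarrow> 'o set \<Rightarrow> 'b" where
  "on_classes \<phi> X = the_elem (\<phi> ` X)"


section \<open>Topological groups and their continuous actions\<close>

definition algebraic_base :: "('g, 'b) monoid_scheme \<Rightarrow> 'g set set \<Rightarrow> bool" where
  "algebraic_base G \<B> \<longleftrightarrow> \<B> \<noteq> {} \<and> (\<forall>H\<in>\<B>. subgroup H G) \<and>
     (\<forall>H\<in>\<B>. \<forall>K\<in>\<B>. \<exists>L\<in>\<B>. L \<subseteq> H \<inter> K) \<and>
     (\<forall>H\<in>\<B>. \<forall>g\<in>carrier G. (\<lambda>h. g \<otimes>\<^bsub>G\<^esub> h \<otimes>\<^bsub>G\<^esub> inv\<^bsub>G\<^esub> g) ` H \<in> \<B>)"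

definition topological_group :: "('g, 'b) monoid_scheme \<Rightarrow> 'g topology \<Rightarrow> bool" where
  "topological_group G T \<longleftrightarrow> group G \<and> topspace T = carrier G \<and>
     continuous_map (prod_topology T T) T (\<lambda>(x, y). x \<otimes>\<^bsub>G\<^esub> y) \<and>
     continuous_map T T (m_inv G)"

definition neighbourhood_basis :: "'g topology \<Rightarrow> 'g \<Rightarrow> 'g set set \<Rightarrow> bool" where
  "neighbourhood_basis T x \<B> \<longleftrightarrow>
     (\<forall>N\<in>\<B>. N \<subseteq> topspace T \<and> (\<exists>W. openin T W \<and> x \<in> W \<and> W \<subseteq> N)) \<and>
     (\<forall>W. openin T W \<and> x \<in> W \<longrightarrow> (\<exists>N\<in>\<B>. N \<subseteq> W))"

text \<open>\<open>Cont(G)\<close>: the objects are the pairs of a set \<open>X\<close> and a continuous action on discrete \<open>X\<close>.\<close>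

definition continuous_action ::
  "('g, 'b) monoid_scheme \<Rightarrow> 'g topology \<Rightarrow> 'v set \<Rightarrow> ('g \<Rightarrow> 'v \<Rightarrow> 'v) \<Rightarrow> bool" where
  "continuous_action G T X \<alpha> \<longleftrightarrow> group_action G X \<alpha> \<and>
     continuous_map (prod_topology T (discrete_topology X)) (discrete_topology X)
       (\<lambda>(g, x). \<alpha> g x)"

definition cont_cat ::
  "('g, 'b) monoid_scheme \<Rightarrow> 'g topology \<Rightarrow> ('v set \<times> ('g \<Rightarrow> 'v \<Rightarrow> 'v), 'v \<Rightarrow> 'v) cat" where
  "cont_cat G T =
     \<lparr>Ob = {(X, \<alpha>). continuous_action G T X \<alpha>},
      Hom = (\<lambda>(X, \<alpha>) (Y, \<beta>).
               {h \<in> X \<rightarrow>\<^sub>E Y. \<forall>g\<in>carrier G. \<forall>x\<in>X. h (\<alpha> g x) = \<beta> g (h x)}),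
      Ident = (\<lambda>(X, \<alpha>). \<lambda>x\<in>X. x),
      Comp = (\<lambda>(X, \<alpha>) (Y, \<beta>) (Z, \<gamma>) k h. compose X k h)\<rparr>"

text \<open>
  The functor \<open>C\<^sup>o\<^sup>p \<rightarrow> Cont(Aut(u))\<close>, \<open>c \<mapsto> Hom(c, u)\<close>.  An arrow of \<open>C\<^sup>o\<^sup>p\<close> from \<open>c\<close> to \<open>d\<close>
  is an arrow \<open>f : d \<rightarrow> c\<close> of \<open>C\<close>.
\<close>

definition hom_action_functor ::
  "('p, 'v) cat \<Rightarrow> ('o, 'm, 'p, 'v) cfunctor \<Rightarrow> 'p
     \<Rightarrow> ('o, 'm, 'v set \<times> ('v \<Rightarrow> 'v \<Rightarrow> 'v), 'v \<Rightarrow> 'v) cfunctor" where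
  "hom_action_functor D \<iota> u =
     \<lparr>fob = (\<lambda>c. (Hom D (fob \<iota> c) u, \<lambda>g. \<lambda>\<chi>\<in>Hom D (fob \<iota> c) u. Comp D (fob \<iota> c) u u g \<chi>)),
      far = (\<lambda>c d f. \<lambda>\<chi>\<in>Hom D (fob \<iota> c) u. Comp D (fob \<iota> d) (fob \<iota> c) u \<chi> (far \<iota> d c f))\<rparr>"

end

theory Submission
  imports Defs
begin

text \<open>
  Since the topology is subcanonical, the sheafified Yoneda embedding is fully faithful, and so is
  the functor \<open>A : c \<mapsto> Hom(c, u)\<close> that extends to the equivalence.  Ultrahomogeneity makes every
  \<open>A c\<close> transitive.  Conversely, a non-empty transitive action is an atom of \<open>Cont(Aut(u))\<close>; atoms
  are reflected by equivalences, so atomic completeness provides some \<open>c\<close> with \<open>A c\<close> isomorphic to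
  it.  Applied to the coset space of an open subgroup \<open>U\<close> this realises \<open>U\<close> as the stabiliser of
  some \<open>\<chi> : c \<rightarrow> u\<close>.  An arrow \<open>\<xi> : a \<rightarrow> u\<close> fixed by \<open>U\<close> is the same as an equivariant map
  \<open>A c \<rightarrow> A a\<close> sending \<open>\<chi>\<close> to \<open>\<xi>\<close>, hence the same as an arrow \<open>a \<rightarrow> c\<close> over \<open>u\<close>; this universal property
  also gives injectivity on isomorphism classes.
\<close>

section \<open>Fully faithful functors and equivalences\<close>

text \<open>Three obstacles shape the argument. Size: the objects of \<open>Cont(G)\<close> are
  carried by subsets of one fixed type, so every auxiliary action has to be realised inside that
  type. Monomorphisms: recognising atoms of \<open>Cont(G)\<close> requires that monomorphisms be
  injective, and the regular action of the group, the usual test object for this, is continuous only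
  if the group is discrete; coset spaces of the intersection of two point stabilisers, which is
  open, take its place. Choice of \<open>l\<close>: atomic completeness and the induced equivalence
  each bring their own sheafified Yoneda embedding. Over a subcanonical topology both are isomorphic
  to the Yoneda embedding itself, so an atom identified through one of them can be read through the
  other.\<close>

locale Category =
  fixes C :: "('o, 'm) cat"
  assumes cat: "category C"
begin

lemma Ident_in: "a \<in> Ob C \<Longrightarrow> Ident C a \<in> Hom C a a"
  using cat unfolding category_def by blast

lemma Comp_in:
  "\<lbrakk>f \<in> Hom C a b; g \<in> Hom C b c; a \<in> Ob C; b \<in> Ob C; c \<in> Ob C\<rbrakk> \<Longrightarrow> Comp C a b c g f \<in> Hom C a c"
  using cat unfolding category_def by blast

lemma Ident_left: "\<lbrakk>f \<in> Hom C a b; a \<in> Ob C; b \<in> Ob C\<rbrakk> \<Longrightarrow> Comp C a b b (Ident C b) f = f"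
  using cat unfolding category_def by blast

lemma Ident_right: "\<lbrakk>f \<in> Hom C a b; a \<in> Ob C; b \<in> Ob C\<rbrakk> \<Longrightarrow> Comp C a a b f (Ident C a) = f"
  using cat unfolding category_def by blast

lemma Comp_assoc:
  "\<lbrakk>f \<in> Hom C a b; g \<in> Hom C b c; h \<in> Hom C c d; a \<in> Ob C; b \<in> Ob C; c \<in> Ob C; d \<in> Ob C\<rbrakk>
   \<Longrightarrow> Comp C a c d h (Comp C a b c g f) = Comp C a b d (Comp C b c d h g) f"
  using cat unfolding category_def by blast

lemma iso_Comp:
  assumes "iso_in C a b f" "iso_in C b c g" and ob: "a \<in> Ob C" "b \<in> Ob C" "c \<in> Ob C"
  shows "iso_in C a c (Comp C a b c g f)"
proof -
  obtain f' where f: "f \<in> Hom C a b" "f' \<in> Hom C b a"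
    "Comp C a b a f' f = Ident C a" "Comp C b a b f f' = Ident C b"
    using assms(1) unfolding iso_in_def by blast
  obtain g' where g: "g \<in> Hom C b c" "g' \<in> Hom C c b"
    "Comp C b c b g' g = Ident C b" "Comp C c b c g g' = Ident C c"
    using assms(2) unfolding iso_in_def by blast
  let ?h = "Comp C a b c g f" and ?k = "Comp C c b a f' g'"
  have h: "?h \<in> Hom C a c" and k: "?k \<in> Hom C c a"
    using f g ob Comp_in by auto
  have "Comp C a c a ?k ?h = Comp C a b a f' (Comp C a c b g' ?h)"
    using Comp_assoc[of ?h a c g' b f' a] f g h ob by simp
  also have "Comp C a c b g' ?h = f"
    using Comp_assoc[of f a b g c g' b] Ident_left f g ob by simp
  finally have 1: "Comp C a c a ?k ?h = Ident C a" using f by simp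
  have "Comp C c a c ?h ?k = Comp C c b c g (Comp C c a b f ?k)"
    using Comp_assoc[of ?k c a f b g c] f g k ob by simp
  also have "Comp C c a b f ?k = g'"
    using Comp_assoc[of g' c b f' a f b] Ident_left f g ob by simp
  finally have 2: "Comp C c a c ?h ?k = Ident C c" using g by simp
  show ?thesis unfolding iso_in_def using 1 2 h k by blast
qed

lemma iso_cancel_left:
  assumes "iso_in C b c k" "f \<in> Hom C a b" "g \<in> Hom C a b"
    "Comp C a b c k f = Comp C a b c k g" "a \<in> Ob C" "b \<in> Ob C" "c \<in> Ob C"
  shows "f = g"
proof -
  obtain k' where k: "k \<in> Hom C b c" "k' \<in> Hom C c b" "Comp C b c b k' k = Ident C b"
    using assms(1) unfolding iso_in_def by blast
  have "Comp C a c b k' (Comp C a b c k h) = h" if "h \<in> Hom C a b" for h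
    using Comp_assoc[OF that k(1,2)] Ident_left[OF that] k(3) assms(5-7) by simp
  with assms(2-4) show ?thesis by metis
qed

lemma iso_cancel_right:
  assumes "iso_in C a b k" "f \<in> Hom C b c" "g \<in> Hom C b c"
    "Comp C a b c f k = Comp C a b c g k" "a \<in> Ob C" "b \<in> Ob C" "c \<in> Ob C"
  shows "f = g"
proof -
  obtain k' where k: "k \<in> Hom C a b" "k' \<in> Hom C b a" "Comp C b a b k k' = Ident C b"
    using assms(1) unfolding iso_in_def by blast
  have "Comp C b a c (Comp C a b c h k) k' = h" if "h \<in> Hom C b c" for h
    using Comp_assoc[OF k(2,1) that] Ident_right[OF that] k(3) assms(5-7) by simp
  with assms(2-4) show ?thesis by metis
qed

lemma isomorphic_trans: "isomorphic_in C a b \<Longrightarrow> isomorphic_in C b c \<Longrightarrow> isomorphic_in C a c"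
  unfolding isomorphic_in_def by (elim conjE exE, intro conjI exI) (assumption | erule (4) iso_Comp)+

end

lemma isomorphic_sym: "isomorphic_in C a b \<Longrightarrow> isomorphic_in C b a"
  unfolding isomorphic_in_def iso_in_def by blast

lemma functor_Ob: "is_functor C D F \<Longrightarrow> a \<in> Ob C \<Longrightarrow> fob F a \<in> Ob D"
  unfolding is_functor_def by blast

lemma functor_Hom:
  "\<lbrakk>is_functor C D F; f \<in> Hom C a b; a \<in> Ob C; b \<in> Ob C\<rbrakk>
   \<Longrightarrow> far F a b f \<in> Hom D (fob F a) (fob F b)"
  unfolding is_functor_def by blast

lemma functor_Ident:
  "\<lbrakk>is_functor C D F; a \<in> Ob C\<rbrakk> \<Longrightarrow> far F a a (Ident C a) = Ident D (fob F a)"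
  unfolding is_functor_def by blast

lemma functor_Comp:
  "\<lbrakk>is_functor C D F; f \<in> Hom C a b; g \<in> Hom C b c; a \<in> Ob C; b \<in> Ob C; c \<in> Ob C\<rbrakk>
   \<Longrightarrow> far F a c (Comp C a b c g f) =
       Comp D (fob F a) (fob F b) (fob F c) (far F b c g) (far F a b f)"
  unfolding is_functor_def by blast

lemma comp_is_functor:
  assumes F: "is_functor A B F" and G: "is_functor B C G"
  shows "is_functor A C (comp_functor G F)"
  by (subst is_functor_def, intro conjI ballI)
    (simp_all add: comp_functor_def functor_Ob[OF F] functor_Ob[OF G] functor_Hom[OF F]
      functor_Hom[OF G] functor_Ident[OF F] functor_Ident[OF G] functor_Comp[OF F] functor_Comp[OF G])

lemma functor_iso:
  assumes F: "is_functor C D F" and "iso_in C a b f" and ob: "a \<in> Ob C" "b \<in> Ob C"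
  shows "iso_in D (fob F a) (fob F b) (far F a b f)"
proof -
  obtain g where f: "f \<in> Hom C a b" "g \<in> Hom C b a"
    "Comp C a b a g f = Ident C a" "Comp C b a b f g = Ident C b"
    using assms(2) unfolding iso_in_def by blast
  have "Comp D (fob F a) (fob F b) (fob F a) (far F b a g) (far F a b f) = Ident D (fob F a)"
    "Comp D (fob F b) (fob F a) (fob F b) (far F a b f) (far F b a g) = Ident D (fob F b)"
    using functor_Comp[OF F f(1,2)] functor_Comp[OF F f(2,1)] functor_Ident[OF F] f ob by simp_all
  then show ?thesis unfolding iso_in_def
    using functor_Hom[OF F] f ob by blast
qed

lemma functor_isomorphic:
  assumes "is_functor C D F" "isomorphic_in C a b"
  shows "isomorphic_in D (fob F a) (fob F b)"
  using assms functor_iso functor_Ob unfolding isomorphic_in_def by metis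

text \<open>Invertibility is asked componentwise: the inverses need not be assembled into a natural
  transformation, and the family need not be extensional. This is the form in which the unit of
  sheafification becomes an isomorphism from \<open>yoneda\<close> to \<open>l\<close>.\<close>

definition nat_iso :: "('o, 'm) cat \<Rightarrow> ('p, 'n) cat \<Rightarrow> ('o, 'm, 'p, 'n) cfunctor
    \<Rightarrow> ('o, 'm, 'p, 'n) cfunctor \<Rightarrow> ('o \<Rightarrow> 'n) \<Rightarrow> bool" where
  "nat_iso C D F G \<sigma> \<longleftrightarrow>
     (\<forall>a\<in>Ob C. iso_in D (fob F a) (fob G a) (\<sigma> a)) \<and>
     (\<forall>a\<in>Ob C. \<forall>b\<in>Ob C. \<forall>f\<in>Hom C a b.
        Comp D (fob F a) (fob F b) (fob G b) (\<sigma> b) (far F a b f) =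
        Comp D (fob F a) (fob G a) (fob G b) (far G a b f) (\<sigma> a))"

lemma isomorphic_functors:
  assumes "isomorphic_in (functor_cat C D) F G"
  obtains \<sigma> where "nat_iso C D F G \<sigma>"
proof -
  obtain \<sigma> \<tau> where st: "\<sigma> \<in> Hom (functor_cat C D) F G" "\<tau> \<in> Hom (functor_cat C D) G F"
    "Comp (functor_cat C D) F G F \<tau> \<sigma> = Ident (functor_cat C D) F"
    "Comp (functor_cat C D) G F G \<sigma> \<tau> = Ident (functor_cat C D) G"
    using assms unfolding isomorphic_in_def iso_in_def by blast
  have "iso_in D (fob F a) (fob G a) (\<sigma> a)" if a: "a \<in> Ob C" for a
    using fun_cong[OF st(3), of a] fun_cong[OF st(4), of a] st(1,2) a
    unfolding iso_in_def functor_cat_def by (auto simp: PiE_iff)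
  then have "nat_iso C D F G \<sigma>"
    using st(1) unfolding nat_iso_def functor_cat_def by simp
  then show thesis by (rule that)
qed

section \<open>Fully faithful functors and their stability under composition and isomorphism\<close>

lemma full_embedding_functor: "full_embedding C D F \<Longrightarrow> is_functor C D F"
  unfolding full_embedding_def by blast

lemma full_embedding_full:
  assumes "full_embedding C D F" "k \<in> Hom D (fob F a) (fob F b)" "a \<in> Ob C" "b \<in> Ob C"
  obtains f where "f \<in> Hom C a b" "far F a b f = k"
proof -
  have "k \<in> far F a b ` Hom C a b"
    using assms unfolding full_embedding_def bij_betw_def by simp
  then show thesis using that by blast
qed

lemma full_embedding_faithful:
  assumes "full_embedding C D F" "far F a b f = far F a b g" "f \<in> Hom C a b" "g \<in> Hom C a b"
    "a \<in> Ob C" "b \<in> Ob C"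
  shows "f = g"
proof -
  have "inj_on (far F a b) (Hom C a b)"
    using assms unfolding full_embedding_def bij_betw_def by simp
  then show ?thesis using assms by (simp add: inj_on_def)
qed

lemma full_embeddingI:
  assumes "is_functor C D F"
    and "\<And>a b f g. \<lbrakk>a \<in> Ob C; b \<in> Ob C; f \<in> Hom C a b; g \<in> Hom C a b; far F a b f = far F a b g\<rbrakk>
      \<Longrightarrow> f = g"
    and "\<And>a b k. \<lbrakk>a \<in> Ob C; b \<in> Ob C; k \<in> Hom D (fob F a) (fob F b)\<rbrakk>
      \<Longrightarrow> \<exists>f\<in>Hom C a b. far F a b f = k"
  shows "full_embedding C D F"
  unfolding full_embedding_def
proof (intro conjI ballI)
  fix a b assume ob: "a \<in> Ob C" "b \<in> Ob C"
  have "inj_on (far F a b) (Hom C a b)"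
    using assms(2) ob unfolding inj_on_def by blast
  moreover have "far F a b ` Hom C a b = Hom D (fob F a) (fob F b)"
    using assms(3)[OF ob] functor_Hom[OF assms(1) _ ob] by blast
  ultimately show "bij_betw (far F a b) (Hom C a b) (Hom D (fob F a) (fob F b))"
    unfolding bij_betw_def by blast
qed (rule assms(1))

lemma full_embedding_id: "full_embedding C C id_functor"
  unfolding full_embedding_def is_functor_def id_functor_def bij_betw_def by simp

lemma full_embedding_comp:
  assumes "full_embedding A B F" "full_embedding B C G"
  shows "full_embedding A C (comp_functor G F)"
  unfolding full_embedding_def
proof (intro conjI ballI)
  show "is_functor A C (comp_functor G F)"
    by (rule comp_is_functor[OF full_embedding_functor[OF assms(1)] full_embedding_functor[OF assms(2)]])
  fix a b assume ob: "a \<in> Ob A" "b \<in> Ob A"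
  note ob' = functor_Ob[OF full_embedding_functor[OF assms(1)] ob(1)]
    functor_Ob[OF full_embedding_functor[OF assms(1)] ob(2)]
  have "bij_betw (far F a b) (Hom A a b) (Hom B (fob F a) (fob F b))"
    "bij_betw (far G (fob F a) (fob F b)) (Hom B (fob F a) (fob F b))
      (Hom C (fob G (fob F a)) (fob G (fob F b)))"
    using assms ob ob' unfolding full_embedding_def by simp_all
  then have "bij_betw (far G (fob F a) (fob F b) \<circ> far F a b) (Hom A a b)
    (Hom C (fob G (fob F a)) (fob G (fob F b)))"
    by (rule bij_betw_trans)
  then show "bij_betw (far (comp_functor G F) a b) (Hom A a b)
    (Hom C (fob (comp_functor G F) a) (fob (comp_functor G F) b))"
    by (simp add: comp_functor_def comp_def)
qed

text \<open>Naturality makes \<open>G f\<close> the conjugate of \<open>F f\<close> by the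
  invertible components, and composing with isomorphisms is bijective on hom-sets.\<close>

lemma full_embedding_nat_iso:
  assumes D: "category D" and F: "full_embedding C D F" and G: "is_functor C D G"
    and s: "nat_iso C D F G \<sigma>"
  shows "full_embedding C D G"
proof (rule full_embeddingI[OF G])
  interpret D: Category D by (unfold_locales) (rule D)
  note F' = full_embedding_functor[OF F]
  fix a b assume ob: "a \<in> Ob C" "b \<in> Ob C"
  note obs = functor_Ob[OF F' ob(1)] functor_Ob[OF F' ob(2)] functor_Ob[OF G ob(1)] functor_Ob[OF G ob(2)]
  have iso: "iso_in D (fob F a) (fob G a) (\<sigma> a)" "iso_in D (fob F b) (fob G b) (\<sigma> b)"
    and nat: "\<And>f. f \<in> Hom C a b \<Longrightarrow> Comp D (fob F a) (fob F b) (fob G b) (\<sigma> b) (far F a b f) =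
        Comp D (fob F a) (fob G a) (fob G b) (far G a b f) (\<sigma> a)"
    using s ob unfolding nat_iso_def by blast+
  {
    fix f g assume fg: "f \<in> Hom C a b" "g \<in> Hom C a b" and "far G a b f = far G a b g"
    then have "Comp D (fob F a) (fob F b) (fob G b) (\<sigma> b) (far F a b f) =
      Comp D (fob F a) (fob F b) (fob G b) (\<sigma> b) (far F a b g)"
      using nat by simp
    then have "far F a b f = far F a b g"
      using D.iso_cancel_left[OF iso(2)] functor_Hom[OF F' _ ob] fg obs by blast
    then show "f = g" using full_embedding_faithful[OF F] fg ob by blast
  next
    fix k assume k: "k \<in> Hom D (fob G a) (fob G b)"
    obtain t where t: "t \<in> Hom D (fob G b) (fob F b)"
      "Comp D (fob G b) (fob F b) (fob G b) (\<sigma> b) t = Ident D (fob G b)"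
      using iso(2) unfolding iso_in_def by blast
    have sa: "\<sigma> a \<in> Hom D (fob F a) (fob G a)" and sb: "\<sigma> b \<in> Hom D (fob F b) (fob G b)"
      using iso unfolding iso_in_def by blast+
    let ?k = "Comp D (fob F a) (fob G a) (fob G b) k (\<sigma> a)"
    have k': "?k \<in> Hom D (fob F a) (fob G b)" using D.Comp_in sa k obs by blast
    then have "Comp D (fob F a) (fob G b) (fob F b) t ?k \<in> Hom D (fob F a) (fob F b)"
      using D.Comp_in t obs by blast
    \<comment> \<open>The preimage of \<open>k\<close> is the arrow whose \<open>F\<close>-image is
      \<open>k\<close> conjugated back along the components; cancelling \<open>\<sigma> a\<close> on
      the right then identifies its \<open>G\<close>-image with \<open>k\<close>.\<close>
    then obtain f where f: "f \<in> Hom C a b"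
      "far F a b f = Comp D (fob F a) (fob G b) (fob F b) t ?k"
      using full_embedding_full[OF F] ob by metis
    have "Comp D (fob F a) (fob F b) (fob G b) (\<sigma> b) (far F a b f) = ?k"
      using D.Comp_assoc[OF k' t(1) sb] D.Ident_left[OF k'] f t obs by simp
    then have "Comp D (fob F a) (fob G a) (fob G b) (far G a b f) (\<sigma> a) = ?k"
      using nat[OF f(1)] by simp
    then have "far G a b f = k"
      using D.iso_cancel_right[OF iso(1) functor_Hom[OF G f(1) ob] k] obs by blast
    then show "\<exists>f\<in>Hom C a b. far G a b f = k" using f by blast
  }
qed

section \<open>Equivalences and what they do to monomorphisms, initial objects and atoms\<close>

lemma equivalence_full_embedding:
  assumes C: "category C" and D: "category D" and e: "equivalence C D \<Phi>"
  shows "full_embedding C D \<Phi>"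
proof -
  have \<Phi>: "is_functor C D \<Phi>" using e unfolding equivalence_def by blast
  obtain \<Psi> where \<Psi>: "is_functor D C \<Psi>"
    and "isomorphic_in (functor_cat C C) (comp_functor \<Psi> \<Phi>) id_functor"
      "isomorphic_in (functor_cat D D) (comp_functor \<Phi> \<Psi>) id_functor"
    using e unfolding equivalence_def by blast
  then obtain \<sigma> \<tau> where 1: "nat_iso C C id_functor (comp_functor \<Psi> \<Phi>) \<sigma>"
    and 2: "nat_iso D D id_functor (comp_functor \<Phi> \<Psi>) \<tau>"
    using isomorphic_functors[OF isomorphic_sym] by metis
  have "is_functor C C (comp_functor \<Psi> \<Phi>)" "is_functor D D (comp_functor \<Phi> \<Psi>)"
    by (rule comp_is_functor[OF \<Phi> \<Psi>], rule comp_is_functor[OF \<Psi> \<Phi>])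
  then have f1: "full_embedding C C (comp_functor \<Psi> \<Phi>)"
    and f2: "full_embedding D D (comp_functor \<Phi> \<Psi>)"
    using full_embedding_nat_iso[OF C full_embedding_id _ 1]
      full_embedding_nat_iso[OF D full_embedding_id _ 2] by simp_all
  show ?thesis
  proof (rule full_embeddingI[OF \<Phi>])
    fix a b assume ob: "a \<in> Ob C" "b \<in> Ob C"
    {
      fix f g assume fg: "f \<in> Hom C a b" "g \<in> Hom C a b" "far \<Phi> a b f = far \<Phi> a b g"
      then have "far (comp_functor \<Psi> \<Phi>) a b f = far (comp_functor \<Psi> \<Phi>) a b g"
        by (simp add: comp_functor_def)
      then show "f = g" using full_embedding_faithful[OF f1] fg ob by blast
    next
      fix k assume k: "k \<in> Hom D (fob \<Phi> a) (fob \<Phi> b)"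
      note ob' = functor_Ob[OF \<Phi> ob(1)] functor_Ob[OF \<Phi> ob(2)]
      let ?k = "far \<Psi> (fob \<Phi> a) (fob \<Phi> b) k"
      have "?k \<in> Hom C (fob (comp_functor \<Psi> \<Phi>) a) (fob (comp_functor \<Psi> \<Phi>) b)"
        using functor_Hom[OF \<Psi> k ob'] by (simp add: comp_functor_def)
      \<comment> \<open>Fullness uses both composites: that of
        \<open>comp_functor \<Psi> \<Phi>\<close> being full supplies an \<open>f\<close> matching
        the \<open>\<Psi>\<close>-image of \<open>k\<close>, and
        \<open>comp_functor \<Phi> \<Psi>\<close> being faithful forces the
        \<open>\<Phi>\<close>-image of this \<open>f\<close> to be \<open>k\<close>.\<close>
      then obtain f where f: "f \<in> Hom C a b" "far (comp_functor \<Psi> \<Phi>) a b f = ?k"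
        using full_embedding_full[OF f1] ob by metis
      have f': "far \<Phi> a b f \<in> Hom D (fob \<Phi> a) (fob \<Phi> b)" using functor_Hom[OF \<Phi> f(1) ob] .
      have "far (comp_functor \<Phi> \<Psi>) (fob \<Phi> a) (fob \<Phi> b) (far \<Phi> a b f) =
        far (comp_functor \<Phi> \<Psi>) (fob \<Phi> a) (fob \<Phi> b) k"
        using f(2) by (simp add: comp_functor_def)
      then have "far \<Phi> a b f = k" using full_embedding_faithful[OF f2 _ f' k ob'] by blast
      then show "\<exists>f\<in>Hom C a b. far \<Phi> a b f = k" using f by blast
    }
  qed
qed

lemma equivalence_ess_surj:
  assumes "equivalence C D \<Phi>" "b \<in> Ob D"
  obtains a where "a \<in> Ob C" "isomorphic_in D (fob \<Phi> a) b"
proof -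
  obtain \<Psi> where \<Psi>: "is_functor C D \<Phi>" "is_functor D C \<Psi>"
    and 2: "isomorphic_in (functor_cat D D) (comp_functor \<Phi> \<Psi>) id_functor"
    using assms(1) unfolding equivalence_def by blast
  obtain \<sigma> where "nat_iso D D (comp_functor \<Phi> \<Psi>) id_functor \<sigma>"
    using isomorphic_functors[OF 2] .
  then have "iso_in D (fob \<Phi> (fob \<Psi> b)) b (\<sigma> b)"
    using assms(2) unfolding nat_iso_def by (simp add: comp_functor_def id_functor_def)
  moreover have "fob \<Psi> b \<in> Ob C" "fob \<Phi> (fob \<Psi> b) \<in> Ob D"
    using functor_Ob[OF \<Psi>(1)] functor_Ob[OF \<Psi>(2)] assms(2) by blast+
  ultimately show thesis using that[of "fob \<Psi> b"] assms(2)
    unfolding isomorphic_in_def by blast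
qed

lemma full_embedding_reflects_iso:
  assumes C: "category C" and F: "full_embedding C D F"
    and f: "f \<in> Hom C a b" and iso: "iso_in D (fob F a) (fob F b) (far F a b f)"
    and ob: "a \<in> Ob C" "b \<in> Ob C"
  shows "iso_in C a b f"
proof -
  interpret C: Category C by unfold_locales (rule C)
  note F' = full_embedding_functor[OF F]
  obtain k where k: "k \<in> Hom D (fob F b) (fob F a)"
    "Comp D (fob F a) (fob F b) (fob F a) k (far F a b f) = Ident D (fob F a)"
    "Comp D (fob F b) (fob F a) (fob F b) (far F a b f) k = Ident D (fob F b)"
    using iso unfolding iso_in_def by blast
  obtain g where g: "g \<in> Hom C b a" "far F b a g = k"
    using full_embedding_full[OF F k(1)] ob by metis
  have "far F a a (Comp C a b a g f) = far F a a (Ident C a)"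
    using functor_Comp[OF F' f g(1)] functor_Ident[OF F'] ob g k by simp
  then have 1: "Comp C a b a g f = Ident C a"
    using full_embedding_faithful[OF F _ C.Comp_in[OF f g(1)] C.Ident_in] ob by blast
  have "far F b b (Comp C b a b f g) = far F b b (Ident C b)"
    using functor_Comp[OF F' g(1) f] functor_Ident[OF F'] ob g k by simp
  then have 2: "Comp C b a b f g = Ident C b"
    using full_embedding_faithful[OF F _ C.Comp_in[OF g(1) f] C.Ident_in] ob by blast
  show ?thesis unfolding iso_in_def using 1 2 f g by blast
qed

text \<open>A test object \<open>y\<close> of \<open>D\<close> need not be in the image of
  \<open>\<Phi>\<close>. It is replaced by an isomorphic \<open>fob \<Phi> x\<close>; after
  precomposition with that isomorphism the two arrows lift to \<open>C\<close>, where
  \<open>m\<close> cancels.\<close>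

lemma equivalence_mono:
  assumes C: "category C" and D: "category D" and e: "equivalence C D \<Phi>"
    and m: "mono_in C a b m" and ob: "a \<in> Ob C" "b \<in> Ob C"
  shows "mono_in D (fob \<Phi> a) (fob \<Phi> b) (far \<Phi> a b m)"
  unfolding mono_in_def
proof (intro conjI ballI impI)
  interpret C: Category C by unfold_locales (rule C)
  interpret D: Category D by unfold_locales (rule D)
  note F = equivalence_full_embedding[OF C D e]
  note F' = full_embedding_functor[OF F]
  note ob' = functor_Ob[OF F' ob(1)] functor_Ob[OF F' ob(2)]
  have mH: "m \<in> Hom C a b" using m unfolding mono_in_def by blast
  then show mH': "far \<Phi> a b m \<in> Hom D (fob \<Phi> a) (fob \<Phi> b)" by (rule functor_Hom[OF F' _ ob])
  fix y g h assume y: "y \<in> Ob D" and g: "g \<in> Hom D y (fob \<Phi> a)" and h: "h \<in> Hom D y (fob \<Phi> a)"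
    and eq: "Comp D y (fob \<Phi> a) (fob \<Phi> b) (far \<Phi> a b m) g = Comp D y (fob \<Phi> a) (fob \<Phi> b) (far \<Phi> a b m) h"
  obtain x where x: "x \<in> Ob C" "isomorphic_in D (fob \<Phi> x) y"
    using equivalence_ess_surj[OF e y] .
  then obtain s where s: "iso_in D (fob \<Phi> x) y s" unfolding isomorphic_in_def by blast
  then have sH: "s \<in> Hom D (fob \<Phi> x) y" unfolding iso_in_def by blast
  note x' = functor_Ob[OF F' x(1)]
  have lift: "\<exists>g'\<in>Hom C x a. far \<Phi> x a g' = Comp D (fob \<Phi> x) y (fob \<Phi> a) k s"
    if "k \<in> Hom D y (fob \<Phi> a)" for k
    using full_embedding_full[OF F D.Comp_in[OF sH that x' y ob'(1)] x(1) ob(1)] by metis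
  obtain g' h' where g': "g' \<in> Hom C x a" "far \<Phi> x a g' = Comp D (fob \<Phi> x) y (fob \<Phi> a) g s"
    and h': "h' \<in> Hom C x a" "far \<Phi> x a h' = Comp D (fob \<Phi> x) y (fob \<Phi> a) h s"
    using lift g h by metis
  have "far \<Phi> x b (Comp C x a b m g') = far \<Phi> x b (Comp C x a b m h')"
    using functor_Comp[OF F' g'(1) mH] functor_Comp[OF F' h'(1) mH] g' h' x ob
      D.Comp_assoc[OF sH g mH'] D.Comp_assoc[OF sH h mH'] x' y ob' eq by simp
  then have "Comp C x a b m g' = Comp C x a b m h'"
    using full_embedding_faithful[OF F _ C.Comp_in[OF g'(1) mH] C.Comp_in[OF h'(1) mH]] x ob by blast
  then have "g' = h'" using m g' h' x unfolding mono_in_def by blast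
  then show "g = h" using D.iso_cancel_right[OF s g h] g' h' x' y ob' by simp
qed

text \<open>Reflection comes from full faithfulness; for preservation each target is first replaced
  by an isomorphic object in the image. Both directions serve atoms: preservation excludes that the
  reflected object is zero, reflection handles its subobjects.\<close>

lemma equivalence_initial:
  assumes C: "category C" and D: "category D" and e: "equivalence C D \<Phi>" and a: "a \<in> Ob C"
  shows "initial_in D (fob \<Phi> a) \<longleftrightarrow> initial_in C a"
proof
  interpret D: Category D by unfold_locales (rule D)
  note F = equivalence_full_embedding[OF C D e]
  note F' = full_embedding_functor[OF F]
  note a' = functor_Ob[OF F' a]
  show "initial_in C a" if i: "initial_in D (fob \<Phi> a)"
    unfolding initial_in_def
  proof (intro conjI ballI a)
    fix b assume b: "b \<in> Ob C"
    then have "\<exists>!k. k \<in> Hom D (fob \<Phi> a) (fob \<Phi> b)"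
      using i functor_Ob[OF F'] unfolding initial_in_def by blast
    then obtain k where k: "k \<in> Hom D (fob \<Phi> a) (fob \<Phi> b)"
      "\<And>k'. k' \<in> Hom D (fob \<Phi> a) (fob \<Phi> b) \<Longrightarrow> k' = k" by blast
    obtain f where f: "f \<in> Hom C a b" "far \<Phi> a b f = k"
      using full_embedding_full[OF F k(1) a b] .
    have "g = f" if g: "g \<in> Hom C a b" for g
      by (rule full_embedding_faithful[OF F _ g f(1) a b]) (simp add: k(2)[OF functor_Hom[OF F' g a b]] f)
    with f show "\<exists>!f. f \<in> Hom C a b" by blast
  qed
  show "initial_in D (fob \<Phi> a)" if i: "initial_in C a"
    unfolding initial_in_def
  proof (intro conjI ballI a')
    fix y assume y: "y \<in> Ob D"
    obtain x where x: "x \<in> Ob C" "isomorphic_in D y (fob \<Phi> x)"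
      using equivalence_ess_surj[OF e y] isomorphic_sym by metis
    then obtain s where s: "iso_in D y (fob \<Phi> x) s" unfolding isomorphic_in_def by blast
    then obtain t where st: "s \<in> Hom D y (fob \<Phi> x)" "t \<in> Hom D (fob \<Phi> x) y"
      unfolding iso_in_def by blast
    note x' = functor_Ob[OF F' x(1)]
    have u: "\<exists>!f. f \<in> Hom C a x" using i x unfolding initial_in_def by blast
    then obtain f where "f \<in> Hom C a x" by blast
    then have "Comp D (fob \<Phi> a) (fob \<Phi> x) y t (far \<Phi> a x f) \<in> Hom D (fob \<Phi> a) y"
      using functor_Hom[OF F' _ a x(1)] D.Comp_in[OF _ st(2) a' x' y] by simp
    moreover have "k = k'" if k: "k \<in> Hom D (fob \<Phi> a) y" "k' \<in> Hom D (fob \<Phi> a) y" for k k'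
    proof (rule D.iso_cancel_left[OF s k _ a' y x'])
      obtain f f' where f: "f \<in> Hom C a x" "far \<Phi> a x f = Comp D (fob \<Phi> a) y (fob \<Phi> x) s k"
        "f' \<in> Hom C a x" "far \<Phi> a x f' = Comp D (fob \<Phi> a) y (fob \<Phi> x) s k'"
        by (rule full_embedding_full[OF F D.Comp_in[OF k(1) st(1) a' y x'] a x(1)],
          rule full_embedding_full[OF F D.Comp_in[OF k(2) st(1) a' y x'] a x(1)])
      then have "f = f'" using u by blast
      with f show "Comp D (fob \<Phi> a) y (fob \<Phi> x) s k = Comp D (fob \<Phi> a) y (fob \<Phi> x) s k'"
        by simp
    qed
    ultimately show "\<exists>!k. k \<in> Hom D (fob \<Phi> a) y" by blast
  qed
qed

text \<open>A monomorphism into \<open>a\<close> is pushed to one into \<open>fob \<Phi> a\<close>.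
  Atomicity there leaves two cases, and each of them is reflected back to \<open>C\<close>.\<close>

lemma equivalence_reflects_atom:
  assumes C: "category C" and D: "category D" and e: "equivalence C D \<Phi>" and a: "a \<in> Ob C"
    and at: "atom_in D (fob \<Phi> a)"
  shows "atom_in C a"
  unfolding atom_in_def
proof (intro conjI ballI allI impI a)
  note F = equivalence_full_embedding[OF C D e]
  note F' = full_embedding_functor[OF F]
  show "\<not> initial_in C a"
    using at equivalence_initial[OF C D e a] unfolding atom_in_def by blast
  fix b m assume b: "b \<in> Ob C" and m: "mono_in C b a m"
  have mH: "m \<in> Hom C b a" using m unfolding mono_in_def by blast
  have "initial_in D (fob \<Phi> b) \<or> iso_in D (fob \<Phi> b) (fob \<Phi> a) (far \<Phi> b a m)"
    using at equivalence_mono[OF C D e m b a] functor_Ob[OF F' b] unfolding atom_in_def by simp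
  then show "initial_in C b \<or> iso_in C b a m"
    using equivalence_initial[OF C D e b] full_embedding_reflects_iso[OF C F mH _ b a] by blast
qed

section \<open>The topos of continuous actions\<close>

lemma Ob_cont: "A \<in> Ob (cont_cat G T) \<longleftrightarrow> continuous_action G T (fst A) (snd A)"
  by (simp add: cont_cat_def case_prod_beta)

lemma Hom_cont: "h \<in> Hom (cont_cat G T) A B \<longleftrightarrow>
    h \<in> fst A \<rightarrow>\<^sub>E fst B \<and> (\<forall>g\<in>carrier G. \<forall>x\<in>fst A. h (snd A g x) = snd B g (h x))"
  by (simp add: cont_cat_def case_prod_beta)

lemma Ident_cont: "Ident (cont_cat G T) A = (\<lambda>x\<in>fst A. x)"
  by (simp add: cont_cat_def case_prod_beta)

lemma Comp_cont: "Comp (cont_cat G T) A B C k h = compose (fst A) k h"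
  by (simp add: cont_cat_def case_prod_beta)

text \<open>The empty action counts as transitive, so non-emptiness is required separately wherever
  atoms are concerned.\<close>

definition transitive_obj :: "('g, 'b) monoid_scheme \<Rightarrow> 'v set \<times> ('g \<Rightarrow> 'v \<Rightarrow> 'v) \<Rightarrow> bool" where
  "transitive_obj G A \<longleftrightarrow> (\<forall>x\<in>fst A. \<forall>y\<in>fst A. \<exists>g\<in>carrier G. snd A g x = y)"

locale Top_Group = group G for G :: "('g, 'b) monoid_scheme" (structure) +
  fixes T :: "'g topology"
  assumes topological_group: "topological_group G T"
begin

lemma topspace_eq: "topspace T = carrier G"
  using topological_group unfolding topological_group_def by blast

lemma inv_mult_cancel:
  "\<lbrakk>x \<in> carrier G; y \<in> carrier G\<rbrakk> \<Longrightarrow> inv x \<otimes> (x \<otimes> y) = y"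
  "\<lbrakk>x \<in> carrier G; y \<in> carrier G\<rbrakk> \<Longrightarrow> x \<otimes> (inv x \<otimes> y) = y"
  by (simp_all add: m_assoc[symmetric])

text \<open>The two-sided translate is what coset spaces call for: \<open>h\<close> moves the coset
  of \<open>k\<close> to the coset of \<open>g \<otimes> k\<close> exactly when
  \<open>inv (g \<otimes> k) \<otimes> h \<otimes> k\<close> lies in \<open>U\<close>.\<close>

lemma openin_translate:
  assumes "openin T U" "a \<in> carrier G" "b \<in> carrier G"
  shows "openin T {h \<in> carrier G. a \<otimes> h \<otimes> b \<in> U}"
proof -
  have mult: "continuous_map (prod_topology T T) T (\<lambda>(x, y). x \<otimes> y)"
    using topological_group unfolding topological_group_def by blast
  have "continuous_map T (prod_topology T T) (\<lambda>h. (a, h))"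
    using assms topspace_eq by (intro continuous_map_pairedI) auto
  from continuous_map_compose[OF this mult]
  have "continuous_map T T (\<lambda>h. a \<otimes> h)" by (simp add: comp_def)
  then have "continuous_map T (prod_topology T T) (\<lambda>h. (a \<otimes> h, b))"
    using assms topspace_eq by (intro continuous_map_pairedI) auto
  from continuous_map_compose[OF this mult]
  have "continuous_map T T (\<lambda>h. a \<otimes> h \<otimes> b)" by (simp add: comp_def)
  from openin_continuous_map_preimage[OF this assms(1)] show ?thesis
    by (simp add: topspace_eq)
qed

text \<open>As \<open>X\<close> is discrete, joint continuity at \<open>(g, x)\<close> is witnessed
  by the box with sides \<open>{h \<in> carrier G. \<alpha> h x = \<alpha> g x}\<close> and
  \<open>{x}\<close>, so openness of the first side is what has to be checked. Extensionality is
  part of \<open>ext\<close> because \<open>Bij X\<close> consists of extensional maps.\<close>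

lemma continuous_actionI:
  assumes ext: "\<And>g. g \<in> carrier G \<Longrightarrow> \<alpha> g \<in> X \<rightarrow>\<^sub>E X"
    and one: "\<And>x. x \<in> X \<Longrightarrow> \<alpha> \<one> x = x"
    and mult: "\<And>g h x. \<lbrakk>g \<in> carrier G; h \<in> carrier G; x \<in> X\<rbrakk> \<Longrightarrow> \<alpha> (g \<otimes> h) x = \<alpha> g (\<alpha> h x)"
    and op: "\<And>g x. \<lbrakk>g \<in> carrier G; x \<in> X\<rbrakk> \<Longrightarrow> openin T {h \<in> carrier G. \<alpha> h x = \<alpha> g x}"
  shows "continuous_action G T X \<alpha>"
  unfolding continuous_action_def
proof
  have in_X: "\<alpha> g x \<in> X" if "g \<in> carrier G" "x \<in> X" for g x
    using ext[OF that(1)] that(2) by blast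
  have bij: "\<alpha> g \<in> Bij X" if g: "g \<in> carrier G" for g
  proof -
    have "\<alpha> (inv g) (\<alpha> g x) = x" "\<alpha> g (\<alpha> (inv g) x) = x" if "x \<in> X" for x
      using mult[of "inv g" g x] mult[of g "inv g" x] one that g by auto
    then have "bij_betw (\<alpha> g) X X"
      using g in_X by (intro bij_betw_byWitness[where f' = "\<alpha> (inv g)"]) auto
    then show ?thesis using ext[OF g] by (simp add: Bij_def PiE_def)
  qed
  have "\<alpha> (g \<otimes> h) = compose X (\<alpha> g) (\<alpha> h)" if "g \<in> carrier G" "h \<in> carrier G" for g h
    using mult that ext[of "g \<otimes> h"]
    by (intro extensionalityI[of _ X]) (auto simp: compose_def PiE_def)
  then have "\<alpha> \<in> hom G (BijGroup X)"
    using bij by (auto simp: hom_def BijGroup_def)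
  then show "group_action G X \<alpha>"
    by (auto intro!: group_action.intro group_hom.intro group_BijGroup is_group
        simp: group_hom_axioms_def)
  show "continuous_map (prod_topology T (discrete_topology X)) (discrete_topology X) (\<lambda>(g, x). \<alpha> g x)"
    unfolding continuous_map_def
  proof (intro conjI allI impI)
    show "(\<lambda>(g, x). \<alpha> g x) \<in> topspace (prod_topology T (discrete_topology X)) \<rightarrow> topspace (discrete_topology X)"
      using in_X by (auto simp: topspace_eq)
    fix V assume "openin (discrete_topology X) V"
    show "openin (prod_topology T (discrete_topology X))
      {p \<in> topspace (prod_topology T (discrete_topology X)). (case p of (g, x) \<Rightarrow> \<alpha> g x) \<in> V}"
      unfolding openin_prod_topology_alt
    proof (intro allI impI)
      fix g x assume "(g, x) \<in> {p \<in> topspace (prod_topology T (discrete_topology X)).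
        (case p of (g, x) \<Rightarrow> \<alpha> g x) \<in> V}"
      then have gx: "g \<in> carrier G" "x \<in> X" "\<alpha> g x \<in> V" by (auto simp: topspace_eq)
      show "\<exists>W Z. openin T W \<and> openin (discrete_topology X) Z \<and> g \<in> W \<and> x \<in> Z \<and>
        W \<times> Z \<subseteq> {p \<in> topspace (prod_topology T (discrete_topology X)). (case p of (g, x) \<Rightarrow> \<alpha> g x) \<in> V}"
        using op[OF gx(1,2)] gx
        by (intro exI[of _ "{h \<in> carrier G. \<alpha> h x = \<alpha> g x}"] exI[of _ "{x}"]) (auto simp: topspace_eq)
    qed
  qed
qed

section \<open>Points, stabilisers and morphisms of continuous actions\<close>

lemma cont_group_action: "A \<in> Ob (cont_cat G T) \<Longrightarrow> group_action G (fst A) (snd A)"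
  unfolding Ob_cont continuous_action_def by blast

lemma cont_act:
  assumes "A \<in> Ob (cont_cat G T)" "x \<in> fst A"
  shows "g \<in> carrier G \<Longrightarrow> snd A g x \<in> fst A"
    and "snd A \<one> x = x"
    and "\<lbrakk>g \<in> carrier G; h \<in> carrier G\<rbrakk> \<Longrightarrow> snd A (g \<otimes> h) x = snd A g (snd A h x)"
    and "g \<in> carrier G \<Longrightarrow> snd A (inv g) (snd A g x) = x"
proof -
  interpret group_action G "fst A" "snd A" using cont_group_action assms(1) .
  show "g \<in> carrier G \<Longrightarrow> snd A g x \<in> fst A" using element_image assms(2) by blast
  show "snd A \<one> x = x" using id_eq_one assms(2) by (metis restrict_apply')
  show "\<lbrakk>g \<in> carrier G; h \<in> carrier G\<rbrakk> \<Longrightarrow> snd A (g \<otimes> h) x = snd A g (snd A h x)"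
    using composition_rule assms(2) by blast
  show "g \<in> carrier G \<Longrightarrow> snd A (inv g) (snd A g x) = x"
    using orbit_sym_aux assms(2) by blast
qed

lemma stabilizer_subgroup:
  "A \<in> Ob (cont_cat G T) \<Longrightarrow> x \<in> fst A \<Longrightarrow> subgroup (stabilizer G (snd A) x) G"
  using group_action.stabilizer_subgroup[OF cont_group_action] .

lemma stabilizer_open:
  assumes "A \<in> Ob (cont_cat G T)" "x \<in> fst A"
  shows "openin T (stabilizer G (snd A) x)"
proof -
  have "continuous_map T (prod_topology T (discrete_topology (fst A))) (\<lambda>g. (g, x))"
    using assms by (intro continuous_map_pairedI) auto
  moreover have "continuous_map (prod_topology T (discrete_topology (fst A))) (discrete_topology (fst A))
      (\<lambda>(g, x). snd A g x)"
    using assms(1) unfolding Ob_cont continuous_action_def by blast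
  ultimately have "continuous_map T (discrete_topology (fst A)) ((\<lambda>(g, x). snd A g x) \<circ> (\<lambda>g. (g, x)))"
    by (rule continuous_map_compose)
  then have "continuous_map T (discrete_topology (fst A)) (\<lambda>g. snd A g x)"
    by (simp add: comp_def)
  from openin_continuous_map_preimage[OF this, of "{x}"] show ?thesis
    using assms by (simp add: stabilizer_def topspace_eq)
qed

lemma category_cont: "category (cont_cat G T)"
  unfolding category_def
proof (intro conjI ballI)
  fix A B C D :: "'v set \<times> ('g \<Rightarrow> 'v \<Rightarrow> 'v)" and f g h
  assume A: "A \<in> Ob (cont_cat G T)"
  show "Ident (cont_cat G T) A \<in> Hom (cont_cat G T) A A"
    using cont_act(1)[OF A] by (simp add: Hom_cont Ident_cont)
  assume f: "f \<in> Hom (cont_cat G T) A B"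
  then have f': "f \<in> fst A \<rightarrow> fst B" "f \<in> extensional (fst A)"
    unfolding Hom_cont by (auto simp: PiE_def)
  show "Comp (cont_cat G T) A A B f (Ident (cont_cat G T) A) = f"
    using f' by (simp add: Comp_cont Ident_cont)
  show "Comp (cont_cat G T) A B B (Ident (cont_cat G T) B) f = f"
    using f' by (simp add: Comp_cont Ident_cont)
  assume g: "g \<in> Hom (cont_cat G T) B C"
  show "Comp (cont_cat G T) A B C g f \<in> Hom (cont_cat G T) A C"
    using f g cont_act(1)[OF A] by (auto simp: Hom_cont Comp_cont compose_def PiE_iff)
  show "Comp (cont_cat G T) A C D h (Comp (cont_cat G T) A B C g f) =
    Comp (cont_cat G T) A B D (Comp (cont_cat G T) B C D h g) f"
    using f' by (simp add: Comp_cont compose_assoc)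
qed

text \<open>The value \<open>undefined\<close> is dictated by extensionality, being the one taken by
  the unique extensional function on the empty set. As no map leads from a non-empty set to this
  object, it shows that non-empty actions are not initial.\<close>

lemma empty_action: "({}, \<lambda>g x. undefined) \<in> Ob (cont_cat G T)"
  unfolding Ob_cont by (rule continuous_actionI) auto

text \<open>The coset space of \<open>U\<close> is modelled on chosen coset representatives, so that it is again a
  subset of the type underlying \<open>G\<close>.\<close>

lemma coset_action:
  fixes U :: "'g set"
  assumes U: "subgroup U G" "openin T U"
  obtains A :: "'g set \<times> ('g \<Rightarrow> 'g \<Rightarrow> 'g)" and x where "A \<in> Ob (cont_cat G T)" "x \<in> fst A"
    "transitive_obj G A" "stabilizer G (snd A) x = U"
proof -
  interpret U: subgroup U G by (rule U(1))
  \<comment> \<open>\<open>r g\<close> is a chosen member of the left coset of \<open>g\<close>. The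
    predicate under \<open>SOME\<close> depends on \<open>g\<close> only through this coset, which
    is why equal cosets receive the same representative.\<close>
  define r where "r g = (SOME h. h \<in> carrier G \<and> inv g \<otimes> h \<in> U)" for g
  have r: "r g \<in> carrier G \<and> inv g \<otimes> r g \<in> U" if "g \<in> carrier G" for g
    unfolding r_def by (rule someI[of _ g]) (simp add: that)
  have swap: "inv h \<otimes> g \<in> U" if "inv g \<otimes> h \<in> U" "g \<in> carrier G" "h \<in> carrier G" for g h
    using U.m_inv_closed[OF that(1)] that by (simp add: inv_mult_group)
  have trans: "inv g \<otimes> k \<in> U"
    if "inv g \<otimes> h \<in> U" "inv h \<otimes> k \<in> U" "g \<in> carrier G" "h \<in> carrier G" "k \<in> carrier G" for g h k
    using U.m_closed[OF that(1,2)] that by (simp add: m_assoc inv_mult_cancel)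
  have r_eq: "r g = r h \<longleftrightarrow> inv g \<otimes> h \<in> U" if gh: "g \<in> carrier G" "h \<in> carrier G" for g h
  proof
    assume "r g = r h"
    then have "inv g \<otimes> r g \<in> U" "inv h \<otimes> r g \<in> U" "r g \<in> carrier G"
      using r[OF gh(1)] r[OF gh(2)] by simp_all
    then show "inv g \<otimes> h \<in> U" using swap trans gh by blast
  next
    assume "inv g \<otimes> h \<in> U"
    then have "(k \<in> carrier G \<and> inv g \<otimes> k \<in> U) = (k \<in> carrier G \<and> inv h \<otimes> k \<in> U)" for k
      using swap trans gh by blast
    then show "r g = r h" unfolding r_def by simp
  qed
  \<comment> \<open>Replacing an element by its representative before multiplying on the left does
    not change the resulting coset; this makes the action on representatives compatible with
    products.\<close>
  have rr: "r (g \<otimes> r h) = r (g \<otimes> h)" if gh: "g \<in> carrier G" "h \<in> carrier G" for g h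
  proof -
    have "inv (r h) \<otimes> h \<in> U" using swap r gh by blast
    then show ?thesis using r[OF gh(2)] gh
      by (subst r_eq) (simp_all add: inv_mult_group m_assoc inv_mult_cancel)
  qed
  define A where "A = (r ` carrier G, \<lambda>g. \<lambda>x\<in>r ` carrier G. r (g \<otimes> x))"
  have act: "snd A g (r h) = r (g \<otimes> h)" if "g \<in> carrier G" "h \<in> carrier G" for g h
    using that rr unfolding A_def by simp
  have "continuous_action G T (fst A) (snd A)"
  proof (rule continuous_actionI)
    show "snd A g \<in> fst A \<rightarrow>\<^sub>E fst A" if "g \<in> carrier G" for g
      using that r unfolding A_def by auto
    show "snd A \<one> x = x" if "x \<in> fst A" for x
      using that act unfolding A_def by auto
    show "snd A (g \<otimes> h) x = snd A g (snd A h x)"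
      if gh: "g \<in> carrier G" "h \<in> carrier G" and x: "x \<in> fst A" for g h x
    proof -
      obtain k where k: "k \<in> carrier G" "x = r k" using x unfolding A_def by auto
      show ?thesis using gh k by (simp add: act m_assoc)
    qed
    show "openin T {h \<in> carrier G. snd A h x = snd A g x}"
      if g: "g \<in> carrier G" and x: "x \<in> fst A" for g x
    proof -
      obtain k where k: "k \<in> carrier G" "x = r k" using x unfolding A_def by auto
      have "{h \<in> carrier G. snd A h x = snd A g x} =
        {h \<in> carrier G. inv (g \<otimes> k) \<otimes> h \<otimes> k \<in> U}"
        using g k by (auto simp: act r_eq m_assoc dest: swap)
          (metis (no_types, lifting) act r_eq m_assoc m_closed inv_closed)+
      then show ?thesis using openin_translate[OF U(2)] g k by simp
    qed
  qed
  then have "A \<in> Ob (cont_cat G T)" unfolding Ob_cont .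
  moreover have "r \<one> \<in> fst A" unfolding A_def by simp
  moreover have "transitive_obj G A"
    unfolding transitive_obj_def
  proof (intro ballI)
    fix x y assume "x \<in> fst A" "y \<in> fst A"
    then obtain h k where hk: "h \<in> carrier G" "x = r h" "k \<in> carrier G" "y = r k"
      unfolding A_def by auto
    then have "snd A (k \<otimes> inv h) x = y" by (simp add: act m_assoc)
    then show "\<exists>g\<in>carrier G. snd A g x = y" using hk by blast
  qed
  moreover have "stabilizer G (snd A) (r \<one>) = U"
  proof -
    have "snd A g (r \<one>) = r \<one> \<longleftrightarrow> g \<in> U" if "g \<in> carrier G" for g
      using that r_eq[of \<one> g] by (auto simp: act)
    then show ?thesis unfolding stabilizer_def using U.subset by blast
  qed
  ultimately show thesis by (rule that)
qed

text \<open>The map sends the translate of \<open>x\<close> by \<open>g\<close> to the translate of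
  \<open>y\<close> by \<open>g\<close>. Two group elements carrying \<open>x\<close> to the same
  point differ by an element of its stabiliser, which by \<open>st\<close> also fixes
  \<open>y\<close>, so the choice made by \<open>t\<close> does not matter.\<close>

lemma cont_hom_exists:
  assumes A: "A \<in> Ob (cont_cat G T)" "transitive_obj G A" "x \<in> fst A"
    and B: "B \<in> Ob (cont_cat G T)" "y \<in> fst B"
    and st: "stabilizer G (snd A) x \<subseteq> stabilizer G (snd B) y"
  obtains h where "h \<in> Hom (cont_cat G T) A B" "h x = y"
proof -
  define t where "t z = (SOME g. g \<in> carrier G \<and> snd A g x = z)" for z
  have t: "t z \<in> carrier G \<and> snd A (t z) x = z" if "z \<in> fst A" for z
  proof -
    have "\<exists>g. g \<in> carrier G \<and> snd A g x = z"
      using A(2,3) that unfolding transitive_obj_def by blast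
    then show ?thesis unfolding t_def by (rule someI_ex)
  qed
  have well: "snd B g y = snd B g' y"
    if g: "g \<in> carrier G" "g' \<in> carrier G" and eq: "snd A g x = snd A g' x" for g g'
  proof -
    have "snd A (inv g \<otimes> g') x = x"
      using g cont_act(3,4)[OF A(1,3)] eq by (metis inv_closed)
    then have "inv g \<otimes> g' \<in> stabilizer G (snd A) x"
      using g by (simp add: stabilizer_def)
    then have "inv g \<otimes> g' \<in> stabilizer G (snd B) y" using st by blast
    then have "snd B (g \<otimes> (inv g \<otimes> g')) y = snd B g y"
      using cont_act(3)[OF B, of g "inv g \<otimes> g'"] g by (simp add: stabilizer_def)
    then show ?thesis using g by (simp add: inv_mult_cancel)
  qed
  define h where "h = (\<lambda>z\<in>fst A. snd B (t z) y)"
  have h: "h (snd A g x) = snd B g y" if "g \<in> carrier G" for g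
  proof -
    have "snd A g x \<in> fst A" using cont_act(1)[OF A(1,3)] that .
    then show ?thesis using well[of "t (snd A g x)" g] t that unfolding h_def by simp
  qed
  have "h \<in> Hom (cont_cat G T) A B"
    unfolding Hom_cont
  proof (intro conjI ballI)
    show "h \<in> fst A \<rightarrow>\<^sub>E fst B" using t cont_act(1)[OF B] unfolding h_def by auto
    fix g z assume g: "g \<in> carrier G" and z: "z \<in> fst A"
    have tz: "t z \<in> carrier G" "z = snd A (t z) x" using t[OF z] by simp_all
    have "h (snd A g z) = h (snd A (g \<otimes> t z) x)"
      using cont_act(3)[OF A(1,3) g tz(1)] tz(2) by simp
    also have "\<dots> = snd B g (snd B (t z) y)"
      using h[of "g \<otimes> t z"] cont_act(3)[OF B g tz(1)] g tz(1) by simp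
    also have "snd B (t z) y = h z" using h[OF tz(1)] tz(2) by simp
    finally show "h (snd A g z) = snd B g (h z)" .
  qed
  moreover have "h x = y" using h[of \<one>] cont_act(2)[OF A(1,3)] cont_act(2)[OF B] by simp
  ultimately show thesis by (rule that)
qed

lemma cont_hom_unique:
  assumes "transitive_obj G A" "x \<in> fst A" and h: "h \<in> Hom (cont_cat G T) A B"
    and k: "k \<in> Hom (cont_cat G T) A B" and eq: "h x = k x"
  shows "h = k"
proof (rule extensionalityI[of _ "fst A"])
  show "h \<in> extensional (fst A)" "k \<in> extensional (fst A)" using h k by (auto simp: Hom_cont PiE_def)
  fix z assume "z \<in> fst A"
  then obtain g where g: "g \<in> carrier G" "snd A g x = z"
    using assms(1,2) unfolding transitive_obj_def by blast
  have "h (snd A g x) = snd B g (h x)" "k (snd A g x) = snd B g (k x)"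
    using h k g(1) assms(2) unfolding Hom_cont by simp_all
  then show "h z = k z" using g(2) eq by simp
qed

text \<open>If \<open>m x = m y\<close>, the coset space of the intersection of the two stabilisers
  has one morphism to \<open>A\<close> taking its base point to \<open>x\<close> and another taking
  it to \<open>y\<close>. Followed by \<open>m\<close> they agree at the base point, hence
  everywhere by transitivity, and \<open>m\<close> cancels. The carriers lie in the type of the
  group because the coset space must be an object of the same category.\<close>

lemma cont_mono_inj:
  fixes A B :: "'g set \<times> ('g \<Rightarrow> 'g \<Rightarrow> 'g)"
  assumes A: "A \<in> Ob (cont_cat G T)" and B: "B \<in> Ob (cont_cat G T)"
    and m: "mono_in (cont_cat G T) A B m"
  shows "inj_on m (fst A)"
proof (rule inj_onI)
  fix x y assume x: "x \<in> fst A" and y: "y \<in> fst A" and eq: "m x = m y"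
  let ?U = "stabilizer G (snd A) x \<inter> stabilizer G (snd A) y"
  have "subgroup ?U G" "openin T ?U"
    using stabilizer_subgroup[OF A] stabilizer_open[OF A] x y by (auto intro: subgroups_Inter_pair)
  then obtain P :: "'g set \<times> ('g \<Rightarrow> 'g \<Rightarrow> 'g)" and z where P: "P \<in> Ob (cont_cat G T)" "z \<in> fst P" "transitive_obj G P"
    "stabilizer G (snd P) z = ?U"
    by (rule coset_action)
  have "stabilizer G (snd P) z \<subseteq> stabilizer G (snd A) x"
    "stabilizer G (snd P) z \<subseteq> stabilizer G (snd A) y" using P(4) by auto
  then obtain h k where h: "h \<in> Hom (cont_cat G T) P A" "h z = x"
    and k: "k \<in> Hom (cont_cat G T) P A" "k z = y"
    using cont_hom_exists[OF P(1,3,2) A] x y by metis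
  have mH: "m \<in> Hom (cont_cat G T) A B" using m unfolding mono_in_def by blast
  interpret Category "cont_cat G T" by unfold_locales (rule category_cont)
  have "Comp (cont_cat G T) P A B m h = Comp (cont_cat G T) P A B m k"
    using cont_hom_unique[OF P(3,2) Comp_in[OF h(1) mH P(1) A B] Comp_in[OF k(1) mH P(1) A B]]
      h(2) k(2) eq P(2) by (simp add: Comp_cont compose_def)
  then have "h = k" using m P(1) h(1) k(1) unfolding mono_in_def by blast
  then show "x = y" using h k by simp
qed

lemma cont_bij_iso:
  assumes A: "A \<in> Ob (cont_cat G T)" and m: "m \<in> Hom (cont_cat G T) A B"
    and bij: "bij_betw m (fst A) (fst B)"
  shows "iso_in (cont_cat G T) A B m"
  unfolding iso_in_def
proof (intro conjI m bexI)
  let ?k = "\<lambda>y\<in>fst B. inv_into (fst A) m y"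
  have km: "?k (m x) = x" if "x \<in> fst A" for x
    using bij that by (auto simp: bij_betw_def)
  have mk: "m (?k y) = y" "?k y \<in> fst A" if "y \<in> fst B" for y
    using bij that by (auto simp: bij_betw_def f_inv_into_f inv_into_into)
  show "Comp (cont_cat G T) A B A ?k m = Ident (cont_cat G T) A"
    using km by (auto simp: Comp_cont Ident_cont compose_def fun_eq_iff)
  show "Comp (cont_cat G T) B A B m ?k = Ident (cont_cat G T) B"
    using mk by (auto simp: Comp_cont Ident_cont compose_def fun_eq_iff)
  show "?k \<in> Hom (cont_cat G T) B A"
    unfolding Hom_cont
  proof (intro conjI ballI)
    show "?k \<in> fst B \<rightarrow>\<^sub>E fst A" using mk(2) by auto
    fix g y assume g: "g \<in> carrier G" and y: "y \<in> fst B"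
    have "m (snd A g (?k y)) = snd B g (m (?k y))"
      using m g mk(2)[OF y] unfolding Hom_cont by blast
    then have "snd B g y = m (snd A g (?k y))" using mk(1)[OF y] by simp
    then show "?k (snd B g y) = snd A g (?k y)"
      using km cont_act(1)[OF A mk(2)[OF y] g] by simp
  qed
qed

text \<open>The image of an equivariant map into a transitive action is invariant, hence empty or
  everything. A subobject is therefore either carried by the empty set, which is initial, or
  injective with full image.\<close>

lemma transitive_atom:
  fixes A :: "'g set \<times> ('g \<Rightarrow> 'g \<Rightarrow> 'g)"
  assumes A: "A \<in> Ob (cont_cat G T)" "transitive_obj G A" "fst A \<noteq> {}"
  shows "atom_in (cont_cat G T) A"
  unfolding atom_in_def
proof (intro conjI ballI allI impI A(1))
  show "\<not> initial_in (cont_cat G T) A"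
  proof
    assume "initial_in (cont_cat G T) A"
    then obtain h where "h \<in> Hom (cont_cat G T) A ({}, \<lambda>g x. undefined)"
      using empty_action unfolding initial_in_def by blast
    then have "h \<in> fst A \<rightarrow>\<^sub>E {}" unfolding Hom_cont by simp
    then show False using A(3) by blast
  qed
  fix B m assume B: "B \<in> Ob (cont_cat G T)" and m: "mono_in (cont_cat G T) B A m"
  have mH: "m \<in> Hom (cont_cat G T) B A" using m unfolding mono_in_def by blast
  show "initial_in (cont_cat G T) B \<or> iso_in (cont_cat G T) B A m"
  proof (cases "fst B = {}")
    case True
    then show ?thesis using B unfolding initial_in_def by (simp add: Hom_cont)
  next
    case False
    then obtain y where y: "y \<in> fst B" by blast
    have "x \<in> m ` fst B" if x: "x \<in> fst A" for x
    proof -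
      have "m y \<in> fst A" using mH y unfolding Hom_cont by blast
      then obtain g where g: "g \<in> carrier G" "snd A g (m y) = x"
        using A(2) x unfolding transitive_obj_def by blast
      then have "m (snd B g y) = x" using mH y unfolding Hom_cont by simp
      then show ?thesis using cont_act(1)[OF B y g(1)] by blast
    qed
    moreover have "m ` fst B \<subseteq> fst A" using mH unfolding Hom_cont by blast
    ultimately have "bij_betw m (fst B) (fst A)"
      using cont_mono_inj[OF B A(1) m] unfolding bij_betw_def by blast
    then show ?thesis using cont_bij_iso[OF B mH] by blast
  qed
qed

text \<open>Transitivity is carried over through \<open>h\<close> and \<open>k\<close>. Thus every
  isomorphic copy of a non-empty transitive action is an atom by \<open>transitive_atom\<close>
  itself, with no detour through invariance of atoms.\<close>

lemma transitive_isomorphic: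
  assumes "isomorphic_in (cont_cat G T) A B" "transitive_obj G A" "fst A \<noteq> {}"
  shows "transitive_obj G B" "fst B \<noteq> {}"
proof -
  obtain h k where h: "h \<in> Hom (cont_cat G T) A B" and k: "k \<in> Hom (cont_cat G T) B A"
    and hk: "Comp (cont_cat G T) B A B h k = Ident (cont_cat G T) B"
    using assms(1) unfolding isomorphic_in_def iso_in_def by blast
  have hk': "h (k y) = y" if "y \<in> fst B" for y
    using fun_cong[OF hk, of y] that by (simp add: Comp_cont Ident_cont compose_def)
  have kA: "k y \<in> fst A" if "y \<in> fst B" for y using k that unfolding Hom_cont by blast
  show "transitive_obj G B"
    unfolding transitive_obj_def
  proof (intro ballI)
    fix x y assume xy: "x \<in> fst B" "y \<in> fst B"
    then obtain g where g: "g \<in> carrier G" "snd A g (k x) = k y"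
      using assms(2) kA unfolding transitive_obj_def by blast
    have "h (snd A g (k x)) = snd B g (h (k x))" using h g(1) kA[OF xy(1)] unfolding Hom_cont by blast
    then have "snd B g x = y" using hk' g(2) xy by simp
    then show "\<exists>g\<in>carrier G. snd B g x = y" using g by blast
  qed
  show "fst B \<noteq> {}" using h assms(3) unfolding Hom_cont by blast
qed

end

section \<open>The Yoneda embedding and sheafification\<close>

lemma category_op: "category C \<Longrightarrow> category (op_cat C)"
  unfolding category_def op_cat_def by simp

lemma category_set: "category set_cat"
  unfolding category_def
proof (intro conjI ballI)
  fix A B C D :: "'a set" and f g h
  show "Ident set_cat A \<in> Hom set_cat A A" by (simp add: set_cat_def)
  assume "f \<in> Hom set_cat A B"
  then have f: "f \<in> A \<rightarrow> B" "f \<in> extensional A" by (auto simp: set_cat_def PiE_def)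
  show "Comp set_cat A A B f (Ident set_cat A) = f" "Comp set_cat A B B (Ident set_cat B) f = f"
    using f by (simp_all add: set_cat_def)
  assume "g \<in> Hom set_cat B C"
  then show "Comp set_cat A B C g f \<in> Hom set_cat A C"
    using f by (auto simp: set_cat_def compose_def)
  show "Comp set_cat A C D h (Comp set_cat A B C g f) = Comp set_cat A B D (Comp set_cat B C D h g) f"
    using f by (simp add: set_cat_def compose_assoc)
qed

lemma Hom_functor_cat: "\<tau> \<in> Hom (functor_cat C D) F G \<longleftrightarrow>
    \<tau> \<in> (\<Pi>\<^sub>E a\<in>Ob C. Hom D (fob F a) (fob G a)) \<and>
    (\<forall>a\<in>Ob C. \<forall>b\<in>Ob C. \<forall>f\<in>Hom C a b.
       Comp D (fob F a) (fob F b) (fob G b) (\<tau> b) (far F a b f) =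
       Comp D (fob F a) (fob G a) (fob G b) (far G a b f) (\<tau> a))"
  by (simp add: functor_cat_def)

lemma category_functor_cat:
  fixes C :: "('o, 'm) cat"
  assumes D: "category D"
  shows "category (functor_cat C D)"
  unfolding category_def
proof (intro conjI ballI)
  interpret D: Category D by unfold_locales (rule D)
  fix F G H I :: "('o, 'm, 'a, 'b) cfunctor" and \<tau> \<sigma> \<rho>
  assume "F \<in> Ob (functor_cat C D)"
  then have F: "is_functor C D F" by (simp add: functor_cat_def)
  note FO = functor_Ob[OF F]
  show "Ident (functor_cat C D) F \<in> Hom (functor_cat C D) F F"
    unfolding Hom_functor_cat
    using D.Ident_in D.Ident_left D.Ident_right FO functor_Hom[OF F] by (simp add: functor_cat_def)
  assume "G \<in> Ob (functor_cat C D)"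
  then have G: "is_functor C D G" by (simp add: functor_cat_def)
  note GO = functor_Ob[OF G]
  assume \<tau>: "\<tau> \<in> Hom (functor_cat C D) F G"
  then have \<tau>H: "\<tau> a \<in> Hom D (fob F a) (fob G a)" if "a \<in> Ob C" for a
    using that unfolding Hom_functor_cat by blast
  have ext: "\<tau> \<in> extensional (Ob C)" using \<tau> unfolding Hom_functor_cat by (simp add: PiE_def)
  show "Comp (functor_cat C D) F G G (Ident (functor_cat C D) G) \<tau> = \<tau>"
    "Comp (functor_cat C D) F F G \<tau> (Ident (functor_cat C D) F) = \<tau>"
    using ext \<tau>H FO GO D.Ident_left D.Ident_right
    by (auto intro!: extensionalityI[OF _ ext] simp: functor_cat_def)
  assume "H \<in> Ob (functor_cat C D)"
  then have H: "is_functor C D H" by (simp add: functor_cat_def)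
  note HO = functor_Ob[OF H]
  assume \<sigma>: "\<sigma> \<in> Hom (functor_cat C D) G H"
  then have \<sigma>H: "\<sigma> a \<in> Hom D (fob G a) (fob H a)" if "a \<in> Ob C" for a
    using that unfolding Hom_functor_cat by blast
  have c: "Comp (functor_cat C D) F G H \<sigma> \<tau> a = Comp D (fob F a) (fob G a) (fob H a) (\<sigma> a) (\<tau> a)"
    if "a \<in> Ob C" for a using that by (simp add: functor_cat_def)
  show "Comp (functor_cat C D) F G H \<sigma> \<tau> \<in> Hom (functor_cat C D) F H"
    unfolding Hom_functor_cat
  proof (intro conjI ballI)
    show "Comp (functor_cat C D) F G H \<sigma> \<tau> \<in> (\<Pi>\<^sub>E a\<in>Ob C. Hom D (fob F a) (fob H a))"
      using D.Comp_in[OF \<tau>H \<sigma>H] FO GO HO by (simp add: functor_cat_def)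
    fix a b f assume a: "a \<in> Ob C" and b: "b \<in> Ob C" and f: "f \<in> Hom C a b"
    note Ff = functor_Hom[OF F f a b] and Gf = functor_Hom[OF G f a b] and Hf = functor_Hom[OF H f a b]
    have "Comp D (fob F a) (fob F b) (fob G b) (\<tau> b) (far F a b f) =
      Comp D (fob F a) (fob G a) (fob G b) (far G a b f) (\<tau> a)"
      "Comp D (fob G a) (fob G b) (fob H b) (\<sigma> b) (far G a b f) =
      Comp D (fob G a) (fob H a) (fob H b) (far H a b f) (\<sigma> a)"
      using \<tau> \<sigma> a b f unfolding Hom_functor_cat by blast+
    then show "Comp D (fob F a) (fob F b) (fob H b) (Comp (functor_cat C D) F G H \<sigma> \<tau> b) (far F a b f) =
      Comp D (fob F a) (fob H a) (fob H b) (far H a b f) (Comp (functor_cat C D) F G H \<sigma> \<tau> a)"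
      using D.Comp_assoc[OF Ff \<tau>H[OF b] \<sigma>H[OF b]] D.Comp_assoc[OF \<tau>H[OF a] Gf \<sigma>H[OF b]]
        D.Comp_assoc[OF \<tau>H[OF a] \<sigma>H[OF a] Hf] FO[OF a] FO[OF b] GO[OF a] GO[OF b] HO[OF a] HO[OF b]
        c[OF a] c[OF b] by simp
  qed
  assume "I \<in> Ob (functor_cat C D)"
  then have IO: "a \<in> Ob C \<Longrightarrow> fob I a \<in> Ob D" for a
    using functor_Ob by (simp add: functor_cat_def) 
  assume \<rho>: "\<rho> \<in> Hom (functor_cat C D) H I"
  then have \<rho>H: "\<rho> a \<in> Hom D (fob H a) (fob I a)" if "a \<in> Ob C" for a
    using that unfolding Hom_functor_cat by blast
  show "Comp (functor_cat C D) F H I \<rho> (Comp (functor_cat C D) F G H \<sigma> \<tau>) =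
    Comp (functor_cat C D) F G I (Comp (functor_cat C D) G H I \<rho> \<sigma>) \<tau>"
    using D.Comp_assoc[OF \<tau>H \<sigma>H \<rho>H] FO GO HO IO by (simp add: functor_cat_def cong: restrict_cong)
qed

section \<open>Sheaves as a full subcategory of presheaves\<close>

lemma category_full_subcat: "category C \<Longrightarrow> category (full_subcat C S)"
  unfolding category_def full_subcat_def by simp

text \<open>\<open>iso_in\<close> consults arrows, identities and composition but never the set of
  objects, which is all that the restriction changes.\<close>

lemma iso_in_full_subcat: "iso_in (full_subcat C S) = iso_in C"
  unfolding iso_in_def full_subcat_def by (simp add: fun_eq_iff)

lemma category_psh: "category (psh_cat K)"
  unfolding psh_cat_def by (rule category_functor_cat[OF category_set])

lemma category_sh: "category (sh_cat K J)"
  unfolding sh_cat_def by (rule category_full_subcat[OF category_psh])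

lemma Hom_sh: "Hom (sh_cat K J) = Hom (psh_cat K)"
  and Comp_sh: "Comp (sh_cat K J) = Comp (psh_cat K)"
  and Ident_sh: "Ident (sh_cat K J) = Ident (psh_cat K)"
  and Ob_sh: "P \<in> Ob (sh_cat K J) \<longleftrightarrow> P \<in> Ob (psh_cat K) \<and> is_sheaf K J P"
  by (simp_all add: sh_cat_def full_subcat_def)

lemma iso_in_sh: "iso_in (sh_cat K J) = iso_in (psh_cat K)"
  unfolding sh_cat_def by (rule iso_in_full_subcat)

lemma Ob_psh: "P \<in> Ob (psh_cat K) \<longleftrightarrow> is_functor (op_cat K) set_cat P"
  by (simp add: psh_cat_def functor_cat_def)

lemma Hom_psh: "\<tau> \<in> Hom (psh_cat K) P Q \<longleftrightarrow>
    \<tau> \<in> (\<Pi>\<^sub>E a\<in>Ob K. fob P a \<rightarrow>\<^sub>E fob Q a) \<and>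
    (\<forall>a\<in>Ob K. \<forall>b\<in>Ob K. \<forall>f\<in>Hom K b a.
       compose (fob P a) (\<tau> b) (far P a b f) = compose (fob P a) (far Q a b f) (\<tau> a))"
  by (simp add: psh_cat_def Hom_functor_cat set_cat_def op_cat_def)

lemma Comp_psh: "Comp (psh_cat K) P Q R \<tau> \<sigma> = (\<lambda>a\<in>Ob K. compose (fob P a) (\<tau> a) (\<sigma> a))"
  by (simp add: psh_cat_def functor_cat_def set_cat_def op_cat_def)

lemma Ident_psh: "Ident (psh_cat K) P = (\<lambda>a\<in>Ob K. \<lambda>x\<in>fob P a. x)"
  by (simp add: psh_cat_def functor_cat_def set_cat_def op_cat_def)

lemma yoneda_simps:
  "fob (fob (yoneda K) c) d = Hom K d c"
  "far (fob (yoneda K) c) d e g = (\<lambda>f\<in>Hom K d c. Comp K e d c f g)"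
  "far (yoneda K) c c' h = (\<lambda>d\<in>Ob K. \<lambda>f\<in>Hom K d c. Comp K d c c' h f)"
  by (simp_all add: yoneda_def)

lemma full_embedding_yoneda:
  fixes K :: "('o, 'm) cat"
  assumes K: "category K"
  shows "full_embedding K (psh_cat K) (yoneda K)"
proof (rule full_embeddingI)
  interpret Category K by unfold_locales (rule K)
  have yo: "is_functor (op_cat K) set_cat (fob (yoneda K) c)" if c: "c \<in> Ob K" for c
    unfolding is_functor_def
  proof (intro conjI ballI)
    fix a assume a: "a \<in> Ob (op_cat K)"
    then have a': "a \<in> Ob K" by (simp add: op_cat_def)
    show "fob (fob (yoneda K) c) a \<in> Ob set_cat" by (simp add: set_cat_def)
    show "far (fob (yoneda K) c) a a (Ident (op_cat K) a) = Ident set_cat (fob (fob (yoneda K) c) a)"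
      using Ident_right[OF _ a' c]
      by (simp add: yoneda_simps set_cat_def op_cat_def cong: restrict_cong)
    fix b f assume "b \<in> Ob (op_cat K)" "f \<in> Hom (op_cat K) a b"
    then have b: "b \<in> Ob K" and f: "f \<in> Hom K b a" by (simp_all add: op_cat_def)
    show "far (fob (yoneda K) c) a b f \<in> Hom set_cat (fob (fob (yoneda K) c) a) (fob (fob (yoneda K) c) b)"
      using Comp_in[OF f _ b a' c] by (simp add: yoneda_simps set_cat_def)
    fix d g assume "d \<in> Ob (op_cat K)" "g \<in> Hom (op_cat K) b d"
    then have d: "d \<in> Ob K" and g: "g \<in> Hom K d b" by (simp_all add: op_cat_def)
    show "far (fob (yoneda K) c) a d (Comp (op_cat K) a b d g f) =
      Comp set_cat (fob (fob (yoneda K) c) a) (fob (fob (yoneda K) c) b) (fob (fob (yoneda K) c) d)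
        (far (fob (yoneda K) c) b d g) (far (fob (yoneda K) c) a b f)"
      using Comp_in[OF f _ b a' c] Comp_assoc[OF g f _ d b a' c]
      by (simp add: yoneda_simps set_cat_def op_cat_def compose_def cong: restrict_cong)
  qed
  show "is_functor K (psh_cat K) (yoneda K)"
    unfolding is_functor_def
  proof (intro conjI ballI)
    fix a assume a: "a \<in> Ob K"
    show "fob (yoneda K) a \<in> Ob (psh_cat K)" using yo[OF a] by (simp add: Ob_psh)
    show "far (yoneda K) a a (Ident K a) = Ident (psh_cat K) (fob (yoneda K) a)"
      using Ident_left[OF _ _ a] by (simp add: yoneda_simps Ident_psh cong: restrict_cong)
    fix b f assume b: "b \<in> Ob K" and f: "f \<in> Hom K a b"
    have fg: "Comp K d a b f g \<in> Hom K d b" if "d \<in> Ob K" "g \<in> Hom K d a" for d g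
      using Comp_in[OF that(2) f that(1) a b] .
    show "far (yoneda K) a b f \<in> Hom (psh_cat K) (fob (yoneda K) a) (fob (yoneda K) b)"
      unfolding Hom_psh
    proof (intro conjI ballI)
      show "far (yoneda K) a b f \<in> (\<Pi>\<^sub>E d\<in>Ob K. fob (fob (yoneda K) a) d \<rightarrow>\<^sub>E fob (fob (yoneda K) b) d)"
        using fg by (simp add: yoneda_simps)
      fix d e g assume d: "d \<in> Ob K" and e: "e \<in> Ob K" and g: "g \<in> Hom K e d"
      show "compose (fob (fob (yoneda K) a) d) (far (yoneda K) a b f e) (far (fob (yoneda K) a) d e g) =
        compose (fob (fob (yoneda K) a) d) (far (fob (yoneda K) b) d e g) (far (yoneda K) a b f d)"
        using fg[OF d] Comp_in[OF g _ e d a] Comp_assoc[OF g _ f e d a b] d e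
        by (simp add: yoneda_simps compose_def cong: restrict_cong)
    qed
    fix c g assume c: "c \<in> Ob K" and g: "g \<in> Hom K b c"
    show "far (yoneda K) a c (Comp K a b c g f) = Comp (psh_cat K) (fob (yoneda K) a)
      (fob (yoneda K) b) (fob (yoneda K) c) (far (yoneda K) b c g) (far (yoneda K) a b f)"
      using fg Comp_assoc[OF _ f g _ a b c]
      by (simp add: yoneda_simps Comp_psh compose_def cong: restrict_cong)
  qed
  fix a b assume a: "a \<in> Ob K" and b: "b \<in> Ob K"
  {
    fix f g assume f: "f \<in> Hom K a b" and g: "g \<in> Hom K a b"
      and eq: "far (yoneda K) a b f = far (yoneda K) a b g"
    have "far (yoneda K) a b f a (Ident K a) = far (yoneda K) a b g a (Ident K a)"
      using eq by simp
    then show "f = g"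
      using a Ident_in[OF a] Ident_right[OF f a b] Ident_right[OF g a b] by (simp add: yoneda_simps)
  next
    fix k assume k: "k \<in> Hom (psh_cat K) (fob (yoneda K) a) (fob (yoneda K) b)"
    then have kP: "k \<in> (\<Pi>\<^sub>E d\<in>Ob K. Hom K d a \<rightarrow>\<^sub>E Hom K d b)"
      and nat: "\<And>d e g. \<lbrakk>d \<in> Ob K; e \<in> Ob K; g \<in> Hom K e d\<rbrakk> \<Longrightarrow>
        compose (Hom K d a) (k e) (\<lambda>f\<in>Hom K d a. Comp K e d a f g) =
        compose (Hom K d a) (\<lambda>f\<in>Hom K d b. Comp K e d b f g) (k d)"
      unfolding Hom_psh yoneda_simps by blast+
    have kd: "k d \<in> Hom K d a \<rightarrow>\<^sub>E Hom K d b" if "d \<in> Ob K" for d using kP that by blast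
    \<comment> \<open>The Yoneda element: naturality along \<open>g\<close>, evaluated at the
      identity of \<open>a\<close>, shows in \<open>val\<close> that \<open>k\<close> is composition
      with it.\<close>
    let ?f = "k a (Ident K a)"
    have f: "?f \<in> Hom K a b" using kd[OF a] Ident_in[OF a] by blast
    have val: "k d g = Comp K d a b ?f g" if d: "d \<in> Ob K" and g: "g \<in> Hom K d a" for d g
      using fun_cong[OF nat[OF a d g], of "Ident K a"] Ident_in[OF a] Ident_left[OF g d a] f
      by (simp add: compose_def)
    have "far (yoneda K) a b ?f = k"
    proof (rule extensionalityI[of _ "Ob K"])
      show "far (yoneda K) a b ?f \<in> extensional (Ob K)" by (simp add: yoneda_simps)
      show "k \<in> extensional (Ob K)" using kP by (simp add: PiE_def)
      fix d assume d: "d \<in> Ob K"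
      show "far (yoneda K) a b ?f d = k d"
      proof (rule extensionalityI[of _ "Hom K d a"])
        show "far (yoneda K) a b ?f d \<in> extensional (Hom K d a)" using d by (simp add: yoneda_simps)
        show "k d \<in> extensional (Hom K d a)" using kd[OF d] by (simp add: PiE_def)
      qed (use d val in \<open>simp add: yoneda_simps\<close>)
    qed
    then show "\<exists>f\<in>Hom K a b. far (yoneda K) a b f = k" using f by blast
  }
qed

text \<open>As \<open>P\<close> is a sheaf, its identity factors through \<open>\<eta>\<close> by
  some \<open>\<sigma>\<close>. The other composite and the identity of \<open>S\<close> both give
  \<open>\<eta>\<close> when precomposed with \<open>\<eta>\<close>, so uniqueness in the universal
  property equates them.\<close>

lemma sheafification_of_sheaf:
  assumes P: "is_sheaf K J P" and S: "sheafification K J P S \<eta>"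
  shows "iso_in (psh_cat K) P S \<eta>"
proof -
  interpret Category "psh_cat K" by unfold_locales (rule category_psh)
  have PO: "P \<in> Ob (psh_cat K)" "P \<in> Ob (sh_cat K J)"
    using P unfolding Ob_sh is_sheaf_def by blast+
  have SO: "S \<in> Ob (sh_cat K J)" "S \<in> Ob (psh_cat K)"
    using S unfolding sheafification_def Ob_sh by blast+
  have \<eta>: "\<eta> \<in> Hom (psh_cat K) P S" using S unfolding sheafification_def by blast
  have univ: "\<exists>!\<sigma>. \<sigma> \<in> Hom (psh_cat K) S Q \<and> Comp (psh_cat K) P S Q \<sigma> \<eta> = \<tau>"
    if "Q \<in> Ob (sh_cat K J)" "\<tau> \<in> Hom (psh_cat K) P Q" for Q \<tau>
    using S that unfolding sheafification_def Hom_sh by blast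
  obtain \<sigma> where \<sigma>: "\<sigma> \<in> Hom (psh_cat K) S P" "Comp (psh_cat K) P S P \<sigma> \<eta> = Ident (psh_cat K) P"
    using univ[OF PO(2) Ident_in[OF PO(1)]] by blast
  let ?e = "Comp (psh_cat K) S P S \<eta> \<sigma>"
  have e: "?e \<in> Hom (psh_cat K) S S" using Comp_in[OF \<sigma>(1) \<eta>] SO PO by blast
  have "Comp (psh_cat K) P S S ?e \<eta> = \<eta>"
    using Comp_assoc[OF \<eta> \<sigma>(1) \<eta>] Ident_right[OF \<eta>] \<sigma>(2) SO PO by simp
  moreover have "Comp (psh_cat K) P S S (Ident (psh_cat K) S) \<eta> = \<eta>"
    using Ident_left[OF \<eta>] SO PO by simp
  ultimately have "?e = Ident (psh_cat K) S"
    using univ[OF SO(1) \<eta>] e Ident_in[OF SO(2)] by blast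
  then show ?thesis unfolding iso_in_def using \<eta> \<sigma> by blast
qed

lemma sheafified_yoneda_nat_iso:
  assumes "subcanonical K J" "sheafified_yoneda K J l"
  obtains \<eta> where "nat_iso K (psh_cat K) (yoneda K) l \<eta>"
proof -
  obtain \<eta> where \<eta>: "\<eta> \<in> Hom (functor_cat K (psh_cat K)) (yoneda K) l"
    "\<And>c. c \<in> Ob K \<Longrightarrow> sheafification K J (fob (yoneda K) c) (fob l c) (\<eta> c)"
    using assms(2) unfolding sheafified_yoneda_def by blast
  have "iso_in (psh_cat K) (fob (yoneda K) c) (fob l c) (\<eta> c)" if "c \<in> Ob K" for c
    using sheafification_of_sheaf[OF _ \<eta>(2)[OF that]] assms(1) that unfolding subcanonical_def by blast
  then show thesis
    using that[of \<eta>] \<eta>(1) unfolding nat_iso_def Hom_functor_cat by blast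
qed

text \<open>Full faithfulness is transferred from \<open>yoneda\<close> to \<open>l\<close> among
  presheaves, and sheaves have the same hom-sets.\<close>

lemma full_embedding_sheafified_yoneda:
  assumes K: "category K" and sc: "subcanonical K J" and l: "sheafified_yoneda K J l"
  shows "full_embedding K (sh_cat K J) l"
proof -
  have lf: "is_functor K (sh_cat K J) l" using l unfolding sheafified_yoneda_def by blast
  then have "is_functor K (psh_cat K) l"
    unfolding is_functor_def Hom_sh Comp_sh Ident_sh Ob_sh by simp
  moreover obtain \<eta> where "nat_iso K (psh_cat K) (yoneda K) l \<eta>"
    using sheafified_yoneda_nat_iso[OF sc l] .
  ultimately have "full_embedding K (psh_cat K) l"
    by (rule full_embedding_nat_iso[OF category_psh full_embedding_yoneda[OF K]])
  with lf show ?thesis unfolding full_embedding_def Hom_sh by simp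
qed

text \<open>Both sides are isomorphic to the representable presheaf of \<open>c\<close>, which is
  itself a sheaf. The objectwise comparison suffices for moving an atom from the \<open>l\<close> of
  atomic completeness to that of the equivalence.\<close>

lemma sheafified_yoneda_unique:
  assumes sc: "subcanonical K J" and l: "sheafified_yoneda K J l" and l': "sheafified_yoneda K J l'"
    and c: "c \<in> Ob K"
  shows "isomorphic_in (sh_cat K J) (fob l c) (fob l' c)"
proof -
  have y: "isomorphic_in (sh_cat K J) (fob (yoneda K) c) (fob l c)" if l: "sheafified_yoneda K J l" for l
  proof -
    obtain \<eta> where "nat_iso K (psh_cat K) (yoneda K) l \<eta>"
      using sheafified_yoneda_nat_iso[OF sc l] .
    then have "iso_in (sh_cat K J) (fob (yoneda K) c) (fob l c) (\<eta> c)"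
      using c unfolding nat_iso_def iso_in_sh by blast
    moreover have "is_functor K (sh_cat K J) l" using l unfolding sheafified_yoneda_def by blast
    then have "fob l c \<in> Ob (sh_cat K J)" using c by (rule functor_Ob)
    moreover have "fob (yoneda K) c \<in> Ob (sh_cat K J)"
      using sc c unfolding subcanonical_def Ob_sh is_sheaf_def by blast
    ultimately show ?thesis unfolding isomorphic_in_def by blast
  qed
  show ?thesis
    using Category.isomorphic_trans[OF Category.intro[OF category_sh] isomorphic_sym[OF y[OF l]] y[OF l']] .
qed

section \<open>What an induced equivalence yields for the functor that it extends\<close>

lemma induces_equivalence_full_embedding:
  assumes K: "category K" and sc: "subcanonical K J" and E: "category E"
    and A: "induces_equivalence K J E A"
  shows "full_embedding K E A"
proof -
  obtain l \<Phi> where l: "sheafified_yoneda K J l" and \<Phi>: "equivalence (sh_cat K J) E \<Phi>"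
    and iso: "isomorphic_in (functor_cat K E) (comp_functor \<Phi> l) A" and A': "is_functor K E A"
    using A unfolding induces_equivalence_def by blast
  obtain \<sigma> where s: "nat_iso K E (comp_functor \<Phi> l) A \<sigma>" using isomorphic_functors[OF iso] .
  show ?thesis
    by (rule full_embedding_nat_iso[OF E full_embedding_comp[OF
      full_embedding_sheafified_yoneda[OF K sc l] equivalence_full_embedding[OF category_sh E \<Phi>]] A' s])
qed

text \<open>The chain runs from \<open>X\<close> to \<open>fob \<Phi> P\<close>, to
  \<open>fob \<Phi> (fob l' c)\<close>, to \<open>fob A c\<close>. The equivalence reaches
  \<open>X\<close> only up to isomorphism, and atomicity is reflected from the copy
  \<open>fob \<Phi> P\<close>; hence the assumption on all \<open>Y\<close> isomorphic to
  \<open>X\<close>.\<close>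

lemma induces_equivalence_atom:
  assumes sc: "subcanonical K J" and E: "category E" and A: "induces_equivalence K J E A"
    and l: "sheafified_yoneda K J l"
    and at: "\<And>P. atom_in (sh_cat K J) P \<Longrightarrow> \<exists>c\<in>Ob K. isomorphic_in (sh_cat K J) P (fob l c)"
    and X: "X \<in> Ob E" "\<And>Y. isomorphic_in E X Y \<Longrightarrow> atom_in E Y"
  obtains c where "c \<in> Ob K" "isomorphic_in E X (fob A c)"
proof -
  obtain l' \<Phi> where l': "sheafified_yoneda K J l'" and \<Phi>: "equivalence (sh_cat K J) E \<Phi>"
    and iso: "isomorphic_in (functor_cat K E) (comp_functor \<Phi> l') A"
    and A': "is_functor K E A"
    using A unfolding induces_equivalence_def by blast
  have \<Phi>': "is_functor (sh_cat K J) E \<Phi>" using \<Phi> unfolding equivalence_def by blast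
  interpret E: Category E by unfold_locales (rule E)
  obtain P where P: "P \<in> Ob (sh_cat K J)" "isomorphic_in E X (fob \<Phi> P)"
    using equivalence_ess_surj[OF \<Phi> X(1)] isomorphic_sym by metis
  have "atom_in (sh_cat K J) P"
    using equivalence_reflects_atom[OF category_sh E \<Phi> P(1) X(2)[OF P(2)]] .
  then obtain c where c: "c \<in> Ob K" "isomorphic_in (sh_cat K J) P (fob l c)" using at by blast
  have "isomorphic_in (sh_cat K J) P (fob l' c)"
    using Category.isomorphic_trans[OF Category.intro[OF category_sh] c(2)
      sheafified_yoneda_unique[OF sc l l' c(1)]] .
  then have 1: "isomorphic_in E (fob \<Phi> P) (fob \<Phi> (fob l' c))"
    by (rule functor_isomorphic[OF \<Phi>'])
  obtain \<sigma> where s: "nat_iso K E (comp_functor \<Phi> l') A \<sigma>" using isomorphic_functors[OF iso] .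
  have "iso_in E (fob \<Phi> (fob l' c)) (fob A c) (\<sigma> c)"
    using s c(1) unfolding nat_iso_def by (simp add: comp_functor_def)
  then have 2: "isomorphic_in E (fob \<Phi> (fob l' c)) (fob A c)"
    using 1 functor_Ob[OF A' c(1)] unfolding isomorphic_in_def by blast
  show thesis
    using that[OF c(1) E.isomorphic_trans[OF E.isomorphic_trans[OF P(2) 1] 2]] .
qed

section \<open>Open subgroups and arrows into the homogeneous object\<close>

lemma (in Top_Group) stabilizer_iso:
  assumes "x \<in> fst A" "A \<in> Ob (cont_cat G T)" "iso_in (cont_cat G T) A B h"
  shows "stabilizer G (snd B) (h x) = stabilizer G (snd A) x" "h x \<in> fst B"
proof -
  obtain k where h: "h \<in> Hom (cont_cat G T) A B" and k: "k \<in> Hom (cont_cat G T) B A"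
    and kh: "Comp (cont_cat G T) A B A k h = Ident (cont_cat G T) A"
    using assms(3) unfolding iso_in_def by blast
  have kh': "k (h y) = y" if "y \<in> fst A" for y
    using fun_cong[OF kh, of y] that by (simp add: Comp_cont Ident_cont compose_def)
  have "snd B g (h x) = h x \<longleftrightarrow> snd A g x = x" if g: "g \<in> carrier G" for g
  proof -
    have "snd B g (h x) = h (snd A g x)" using h g assms(1) unfolding Hom_cont by simp
    then show ?thesis using kh'[OF assms(1)] kh'[OF cont_act(1)[OF assms(2,1) g]] by metis
  qed
  then show "stabilizer G (snd B) (h x) = stabilizer G (snd A) x" unfolding stabilizer_def by blast
  show "h x \<in> fst B" using h assms(1) unfolding Hom_cont by blast
qed

text \<open>Here \<open>r\<close> is the kernel relation of \<phi> on \<open>S\<close>, so the claim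
  is the canonical factorisation of \<phi> through the quotient. It reduces the bijection on
  isomorphism classes to a description of when two values agree and of the image.\<close>

lemma bij_betw_on_classes:
  assumes r: "\<And>p q. (p, q) \<in> r \<longleftrightarrow> p \<in> S \<and> q \<in> S \<and> \<phi> p = \<phi> q"
  shows "bij_betw (on_classes \<phi>) (S // r) (\<phi> ` S)"
proof -
  have cls: "r `` {p} = {q \<in> S. \<phi> q = \<phi> p}" if "p \<in> S" for p
    using r that by auto
  have val: "on_classes \<phi> (r `` {p}) = \<phi> p" if p: "p \<in> S" for p
  proof -
    have "\<phi> ` (r `` {p}) = {\<phi> p}" using cls[OF p] p by auto
    then show ?thesis unfolding on_classes_def by simp
  qed
  have quotient_eq: "S // r = (\<lambda>p. r `` {p}) ` S" by (auto simp: quotient_def)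
  show ?thesis
    unfolding bij_betw_def
  proof
    show "inj_on (on_classes \<phi>) (S // r)"
    proof (rule inj_onI)
      fix X Y assume "X \<in> S // r" "Y \<in> S // r" and eq: "on_classes \<phi> X = on_classes \<phi> Y"
      then obtain p q where pq: "p \<in> S" "X = r `` {p}" "q \<in> S" "Y = r `` {q}"
        by (auto simp: quotient_def)
      then have "\<phi> p = \<phi> q" using eq val by simp
      then show "X = Y" using pq cls by simp
    qed
    show "on_classes \<phi> ` (S // r) = \<phi> ` S"
      using val by (simp add: quotient_eq image_image cong: image_cong)
  qed
qed

text \<open>Arrows of \<open>D\<close>, and with them the elements of the automorphism group,
  inhabit the type \<open>'v\<close>. Hence the sets of arrows into \<open>u\<close> and the coset
  spaces of the group are objects of one and the same category \<open>E\<close>.\<close>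

locale Homogeneous_Equivalence =
  fixes C :: "('o, 'v) cat" and D :: "('p, 'v) cat"
    and \<iota> :: "('o, 'v, 'p, 'v) cfunctor" and u :: 'p and T :: "'v topology"
  assumes complete: "atomically_complete C"
    and D: "category D"
    and \<iota>: "full_embedding C D \<iota>"
    and univ: "universal_for C D \<iota> u"
    and homog: "ultrahomogeneous_for C D \<iota> u"
    and top: "topological_group (aut_group D u) T"
    and equiv: "induces_equivalence (op_cat C) (atomic_topology (op_cat C))
           (cont_cat (aut_group D u) T) (hom_action_functor D \<iota> u)"
begin

abbreviation "G \<equiv> aut_group D u"
abbreviation "A \<equiv> hom_action_functor D \<iota> u"
abbreviation "E \<equiv> cont_cat G T"
abbreviation "F \<equiv> fob (fixing_functor D \<iota> u)"

sublocale C: Category C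
  using complete unfolding atomically_complete_def small_category_def by unfold_locales blast

sublocale D: Category D
  by unfold_locales (rule D)

sublocale G: Top_Group G T
proof -
  have "group G" using top unfolding topological_group_def by blast
  then show "Top_Group G T" using top by (simp add: Top_Group_def Top_Group_axioms_def)
qed

lemma u: "u \<in> Ob D"
  using univ unfolding universal_for_def by blast

lemma \<iota>_functor: "is_functor C D \<iota>"
  using \<iota> by (rule full_embedding_functor)

lemma category_op_C: "category (op_cat C)"
  using category_op C.cat .

lemma subcanonical: "subcanonical (op_cat C) (atomic_topology (op_cat C))"
  using complete unfolding atomically_complete_def by blast

lemma A_embedding: "full_embedding (op_cat C) E A"
  by (rule induces_equivalence_full_embedding[OF category_op_C subcanonical G.category_cont equiv])

lemma A_simps:
  "fst (fob A d) = Hom D (fob \<iota> d) u"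
  "\<chi> \<in> Hom D (fob \<iota> d) u \<Longrightarrow> snd (fob A d) g \<chi> = Comp D (fob \<iota> d) u u g \<chi>"
  "\<chi> \<in> Hom D (fob \<iota> d) u \<Longrightarrow> far A d e f \<chi> = Comp D (fob \<iota> e) (fob \<iota> d) u \<chi> (far \<iota> e d f)"
  by (simp_all add: hom_action_functor_def)

lemma op_C_simps: "Ob (op_cat C) = Ob C" "Hom (op_cat C) a b = Hom C b a"
  by (simp_all add: op_cat_def)

lemma A_Ob: "d \<in> Ob C \<Longrightarrow> fob A d \<in> Ob E"
  using functor_Ob[OF full_embedding_functor[OF A_embedding]] by (simp add: op_C_simps)

text \<open>Ultrahomogeneity applied with \<open>j\<close> the identity of \<open>d\<close>.\<close>

lemma A_transitive:
  assumes d: "d \<in> Ob C"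
  shows "transitive_obj G (fob A d)"
  unfolding transitive_obj_def A_simps(1)
proof (intro ballI)
  fix \<chi> \<xi> assume \<chi>: "\<chi> \<in> Hom D (fob \<iota> d) u" and \<xi>: "\<xi> \<in> Hom D (fob \<iota> d) u"
  have "\<exists>k\<in>carrier G. Comp D (fob \<iota> d) u u k \<chi> = Comp D (fob \<iota> d) (fob \<iota> d) u \<xi> (far \<iota> d d (Ident C d))"
    using homog d C.Ident_in[OF d] \<chi> \<xi> unfolding ultrahomogeneous_for_def by blast
  moreover have "Comp D (fob \<iota> d) (fob \<iota> d) u \<xi> (far \<iota> d d (Ident C d)) = \<xi>"
    using D.Ident_right[OF \<xi> functor_Ob[OF \<iota>_functor d] u] functor_Ident[OF \<iota>_functor d] by simp
  ultimately show "\<exists>g\<in>carrier G. snd (fob A d) g \<chi> = \<xi>"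
    using A_simps(2)[OF \<chi>] by simp
qed

section \<open>The slice over \<open>u\<close> and its fixing subgroups\<close>

lemma slice_Ob: "(d, \<chi>) \<in> Ob (slice_cat C D \<iota> u) \<longleftrightarrow> d \<in> Ob C \<and> \<chi> \<in> Hom D (fob \<iota> d) u"
  by (simp add: slice_cat_def)

lemma slice_Hom: "f \<in> Hom (slice_cat C D \<iota> u) (d, \<chi>) (e, \<xi>) \<longleftrightarrow>
    f \<in> Hom C d e \<and> Comp D (fob \<iota> d) (fob \<iota> e) u \<xi> (far \<iota> d e f) = \<chi>"
  by (simp add: slice_cat_def)

lemma F_eq: "F (d, \<chi>) = {f \<in> carrier G. Comp D (fob \<iota> d) u u f \<chi> = \<chi>}"
  by (simp add: fixing_functor_def fixing_subgroup_def)

lemma F_stabilizer: "\<chi> \<in> Hom D (fob \<iota> d) u \<Longrightarrow> F (d, \<chi>) = stabilizer G (snd (fob A d)) \<chi>"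
  by (simp add: F_eq stabilizer_def A_simps)

lemma F_open_subgroup:
  assumes "p \<in> Ob (slice_cat C D \<iota> u)"
  shows "subgroup (F p) G \<and> openin T (F p)"
proof (cases p)
  case (Pair d \<chi>)
  then have "d \<in> Ob C" "\<chi> \<in> Hom D (fob \<iota> d) u" using assms slice_Ob by simp_all
  then show ?thesis
    using G.stabilizer_subgroup[OF A_Ob] G.stabilizer_open[OF A_Ob] Pair F_stabilizer A_simps(1)
    by simp
qed

text \<open>An arrow from \<open>q\<close> to \<open>p\<close> writes the arrow of \<open>q\<close>
  as that of \<open>p\<close> precomposed with something, so whatever fixes the latter fixes the
  former.\<close>

lemma F_antimono:
  assumes "p \<in> Ob (slice_cat C D \<iota> u)" "q \<in> Ob (slice_cat C D \<iota> u)"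
    and f: "f \<in> Hom (slice_cat C D \<iota> u) q p"
  shows "F p \<subseteq> F q"
proof
  obtain d \<chi> e \<xi> where [simp]: "q = (d, \<chi>)" "p = (e, \<xi>)" by (cases p, cases q) blast
  have d: "d \<in> Ob C" and e: "e \<in> Ob C" and \<xi>: "\<xi> \<in> Hom D (fob \<iota> e) u"
    using assms(1,2) by (simp_all add: slice_Ob)
  have f': "f \<in> Hom C d e" "Comp D (fob \<iota> d) (fob \<iota> e) u \<xi> (far \<iota> d e f) = \<chi>"
    using f by (simp_all add: slice_Hom)
  fix k assume "k \<in> F p"
  then have k: "k \<in> carrier G" "Comp D (fob \<iota> e) u u k \<xi> = \<xi>" by (simp_all add: F_eq)
  then have "k \<in> Hom D u u" by (simp add: aut_group_def iso_in_def)
  from D.Comp_assoc[OF functor_Hom[OF \<iota>_functor f'(1) d e] \<xi> this] k f'(2)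
  show "k \<in> F q"
    using functor_Ob[OF \<iota>_functor d] functor_Ob[OF \<iota>_functor e] u by (simp add: F_eq)
qed

text \<open>Transitivity of \<open>A c\<close> makes an inclusion of stabilisers an equivariant map \<open>A c \<rightarrow> A a\<close>,
  and such maps come from unique arrows \<open>a \<rightarrow> c\<close> because \<open>A\<close> is fully faithful.\<close>

lemma F_factor:
  assumes c: "(c, \<chi>) \<in> Ob (slice_cat C D \<iota> u)" and a: "(a, \<xi>) \<in> Ob (slice_cat C D \<iota> u)"
    and sub: "F (c, \<chi>) \<subseteq> F (a, \<xi>)"
  shows "\<exists>!f. f \<in> Hom (slice_cat C D \<iota> u) (a, \<xi>) (c, \<chi>)"
proof -
  have c': "c \<in> Ob C" "\<chi> \<in> Hom D (fob \<iota> c) u" "\<chi> \<in> fst (fob A c)"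
    and a': "a \<in> Ob C" "\<xi> \<in> Hom D (fob \<iota> a) u" "\<xi> \<in> fst (fob A a)"
    using c a by (simp_all add: slice_Ob A_simps)
  obtain h where h: "h \<in> Hom E (fob A c) (fob A a)" "h \<chi> = \<xi>"
    using G.cont_hom_exists[OF A_Ob[OF c'(1)] A_transitive[OF c'(1)] c'(3) A_Ob[OF a'(1)] a'(3)]
      sub F_stabilizer c'(2) a'(2) by metis
  obtain f where f: "f \<in> Hom C a c" "far A c a f = h"
    using full_embedding_full[OF A_embedding h(1)] c'(1) a'(1) by (auto simp: op_C_simps)
  \<comment> \<open>Evaluating \<open>far A c a f\<close> at \<chi> is precomposition of \<chi> with
    the image of \<open>f\<close>, so \<open>h \<chi> = \<xi>\<close> is precisely commutativity of
    the triangle over \<open>u\<close>.\<close>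
  have "f \<in> Hom (slice_cat C D \<iota> u) (a, \<xi>) (c, \<chi>)"
    using f h(2) A_simps(3)[OF c'(2), of a f] by (simp add: slice_Hom)
  moreover have "f = f'"
    if f: "f \<in> Hom (slice_cat C D \<iota> u) (a, \<xi>) (c, \<chi>)"
      and f': "f' \<in> Hom (slice_cat C D \<iota> u) (a, \<xi>) (c, \<chi>)" for f f'
  proof (rule full_embedding_faithful[OF A_embedding, of c a])
    show op: "f \<in> Hom (op_cat C) c a" "f' \<in> Hom (op_cat C) c a" "c \<in> Ob (op_cat C)" "a \<in> Ob (op_cat C)"
      using f f' c'(1) a'(1) by (simp_all add: op_C_simps slice_Hom)
    note H = functor_Hom[OF full_embedding_functor[OF A_embedding] _ op(3,4)]
    \<comment> \<open>Both maps send \<chi> to \<xi>, and transitivity makes an equivariant map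
      determined by one value.\<close>
    show "far A c a f = far A c a f'"
      using f f' A_simps(3)[OF c'(2)]
      by (intro G.cont_hom_unique[OF A_transitive[OF c'(1)] c'(3) H[OF op(1)] H[OF op(2)]])
        (simp add: slice_Hom)
  qed
  ultimately show ?thesis by blast
qed

text \<open>Opposite arrows force opposite inclusions of the subgroups. Conversely, equal subgroups
  give arrows in both directions by \<open>F_factor\<close>, and its uniqueness clause, applied to
  endomorphisms of a single object, makes both composites identities.\<close>

lemma isomorphic_slice_iff:
  "isomorphic_in (slice_cat C D \<iota> u) p q \<longleftrightarrow>
     p \<in> Ob (slice_cat C D \<iota> u) \<and> q \<in> Ob (slice_cat C D \<iota> u) \<and> F p = F q"
proof
  assume "isomorphic_in (slice_cat C D \<iota> u) p q"
  then show "p \<in> Ob (slice_cat C D \<iota> u) \<and> q \<in> Ob (slice_cat C D \<iota> u) \<and> F p = F q"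
    using F_antimono unfolding isomorphic_in_def iso_in_def by blast
next
  assume pq: "p \<in> Ob (slice_cat C D \<iota> u) \<and> q \<in> Ob (slice_cat C D \<iota> u) \<and> F p = F q"
  obtain d \<chi> e \<xi> where [simp]: "p = (d, \<chi>)" "q = (e, \<xi>)" by (cases p, cases q) blast
  have ob: "(d, \<chi>) \<in> Ob (slice_cat C D \<iota> u)" "(e, \<xi>) \<in> Ob (slice_cat C D \<iota> u)" using pq by simp_all
  have eq: "F (d, \<chi>) = F (e, \<xi>)" using pq by simp
  obtain f g where f: "f \<in> Hom (slice_cat C D \<iota> u) (d, \<chi>) (e, \<xi>)"
    and g: "g \<in> Hom (slice_cat C D \<iota> u) (e, \<xi>) (d, \<chi>)"
    using F_factor[OF ob(1,2)] F_factor[OF ob(2,1)] eq by blast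
  \<comment> \<open>Stated for arbitrary objects and arrows because it is used twice, with the two
    roles exchanged.\<close>
  have inverse: "Comp C d e d g f = Ident C d"
    if ob: "(d, \<chi>) \<in> Ob (slice_cat C D \<iota> u)" "(e, \<xi>) \<in> Ob (slice_cat C D \<iota> u)"
      and f: "f \<in> Hom (slice_cat C D \<iota> u) (d, \<chi>) (e, \<xi>)"
      and g: "g \<in> Hom (slice_cat C D \<iota> u) (e, \<xi>) (d, \<chi>)" for d \<chi> e \<xi> f g
  proof -
    have d: "d \<in> Ob C" "\<chi> \<in> Hom D (fob \<iota> d) u" and e: "e \<in> Ob C"
      using ob by (simp_all add: slice_Ob)
    note \<iota>O = functor_Ob[OF \<iota>_functor d(1)] functor_Ob[OF \<iota>_functor e]
    have f': "f \<in> Hom C d e" "Comp D (fob \<iota> d) (fob \<iota> e) u \<xi> (far \<iota> d e f) = \<chi>"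
      and g': "g \<in> Hom C e d" "Comp D (fob \<iota> e) (fob \<iota> d) u \<chi> (far \<iota> e d g) = \<xi>"
      using f g by (simp_all add: slice_Hom)
    note \<iota>f = functor_Hom[OF \<iota>_functor f'(1) d(1) e] and \<iota>g = functor_Hom[OF \<iota>_functor g'(1) e d(1)]
    have "Comp D (fob \<iota> d) (fob \<iota> d) u \<chi> (far \<iota> d d (Comp C d e d g f)) = \<chi>"
      using D.Comp_assoc[OF \<iota>f \<iota>g d(2)] functor_Comp[OF \<iota>_functor f'(1) g'(1) d(1) e d(1)]
        f'(2) g'(2) \<iota>O u by simp
    then have "Comp C d e d g f \<in> Hom (slice_cat C D \<iota> u) (d, \<chi>) (d, \<chi>)"
      using C.Comp_in[OF f'(1) g'(1) d(1) e d(1)] by (simp add: slice_Hom)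
    moreover have "Ident C d \<in> Hom (slice_cat C D \<iota> u) (d, \<chi>) (d, \<chi>)"
      using C.Ident_in[OF d(1)] functor_Ident[OF \<iota>_functor d(1)] D.Ident_right[OF d(2) \<iota>O(1) u]
      by (simp add: slice_Hom)
    ultimately show ?thesis using F_factor[OF ob(1) ob(1)] by blast
  qed
  have "iso_in (slice_cat C D \<iota> u) (d, \<chi>) (e, \<xi>) f"
    unfolding iso_in_def
    using f g inverse[OF ob f g] inverse[OF ob(2,1) g f] by (auto simp: slice_cat_def)
  then show "isomorphic_in (slice_cat C D \<iota> u) p q"
    using pq unfolding isomorphic_in_def by auto
qed

text \<open>The transitive action of \<open>G\<close> on the cosets of \<open>U\<close> is an atom, hence isomorphic to some
  \<open>A d\<close>; the arrow sought is the image of the trivial coset.\<close>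

lemma F_surj:
  assumes U: "subgroup U G" "openin T U"
  obtains p where "p \<in> Ob (slice_cat C D \<iota> u)" "F p = U"
proof -
  obtain X :: "'v set \<times> ('v \<Rightarrow> 'v \<Rightarrow> 'v)" and x where X: "X \<in> Ob E" "x \<in> fst X"
    "transitive_obj G X" "stabilizer G (snd X) x = U"
    using G.coset_action[OF U] .
  obtain l where l: "sheafified_yoneda (op_cat C) (atomic_topology (op_cat C)) l"
    "\<And>P. atom_in (sh_cat (op_cat C) (atomic_topology (op_cat C))) P \<Longrightarrow>
      \<exists>c\<in>Ob C. isomorphic_in (sh_cat (op_cat C) (atomic_topology (op_cat C))) P (fob l c)"
    using complete unfolding atomically_complete_def by blast
  have atoms: "atom_in E Y" if "isomorphic_in E X Y" for Y
    using G.transitive_atom[of Y] G.transitive_isomorphic[OF that X(3)] X(2) that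
    unfolding isomorphic_in_def by blast
  obtain d where d: "d \<in> Ob C" "isomorphic_in E X (fob A d)"
    using induces_equivalence_atom[OF subcanonical G.category_cont equiv l(1) _ X(1) atoms] l(2)
    unfolding op_C_simps by blast
  obtain h where "iso_in E X (fob A d) h" using d(2) unfolding isomorphic_in_def by blast
  note h = G.stabilizer_iso[OF X(2,1) this]
  have "h x \<in> Hom D (fob \<iota> d) u" using h(2) by (simp add: A_simps)
  then show thesis
    using that[of "(d, h x)"] d(1) h(1) X(4) F_stabilizer by (simp add: slice_Ob)
qed

text \<open>By \<open>isomorphic_slice_iff\<close> the isomorphism relation is the kernel of
  \<open>F\<close> on objects, so the bijection onto the image is formal; it remains to see that the
  image is the set of all open subgroups.\<close>

lemma F_bij:
  "bij_betw (on_classes F) (Ob (slice_cat C D \<iota> u) // iso_rel (slice_cat C D \<iota> u))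
     {U. subgroup U G \<and> openin T U}"
proof -
  have "F ` Ob (slice_cat C D \<iota> u) = {U. subgroup U G \<and> openin T U}"
  proof
    show "F ` Ob (slice_cat C D \<iota> u) \<subseteq> {U. subgroup U G \<and> openin T U}"
      using F_open_subgroup by blast
    show "{U. subgroup U G \<and> openin T U} \<subseteq> F ` Ob (slice_cat C D \<iota> u)"
      using F_surj by blast
  qed
  then show ?thesis
    using bij_betw_on_classes[of "iso_rel (slice_cat C D \<iota> u)" "Ob (slice_cat C D \<iota> u)" F]
    by (simp add: iso_rel_def isomorphic_slice_iff)
qed

text \<open>The target is a preorder with at most one arrow between two objects, so functoriality
  amounts to \<open>F_antimono\<close>.\<close>

lemma F_functor:
  "is_functor (op_cat (slice_cat C D \<iota> u)) (subgroup_cat G) (fixing_functor D \<iota> u)"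
  unfolding is_functor_def
proof (intro conjI ballI)
  fix p q f assume "p \<in> Ob (op_cat (slice_cat C D \<iota> u))"
  then have p: "p \<in> Ob (slice_cat C D \<iota> u)" by (simp add: op_cat_def)
  show "F p \<in> Ob (subgroup_cat G)" using F_open_subgroup[OF p] by (simp add: subgroup_cat_def)
  assume "q \<in> Ob (op_cat (slice_cat C D \<iota> u))" "f \<in> Hom (op_cat (slice_cat C D \<iota> u)) p q"
  then have "q \<in> Ob (slice_cat C D \<iota> u)" "f \<in> Hom (slice_cat C D \<iota> u) q p"
    by (simp_all add: op_cat_def)
  from F_antimono[OF p this]
  show "far (fixing_functor D \<iota> u) p q f \<in> Hom (subgroup_cat G) (F p) (F q)"
    by (simp add: subgroup_cat_def)
qed simp_all

text \<open>\<open>F_factor\<close> speaks of arrows of \<open>C\<close>, whereas the factorisation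
  is claimed among arrows of \<open>D\<close>. Every arrow of \<open>D\<close> between images comes
  from \<open>C\<close> by fullness of \<iota>, so existence and uniqueness both carry over.\<close>

lemma F_universal:
  assumes c: "(c, \<chi>) \<in> Ob (slice_cat C D \<iota> u)" and a: "a \<in> Ob C" and \<xi>: "\<xi> \<in> Hom D (fob \<iota> a) u"
    and fixed: "\<forall>f\<in>F (c, \<chi>). Comp D (fob \<iota> a) u u f \<xi> = \<xi>"
  shows "\<exists>!h. h \<in> Hom D (fob \<iota> a) (fob \<iota> c) \<and> Comp D (fob \<iota> a) (fob \<iota> c) u \<chi> h = \<xi>"
proof -
  have "F (c, \<chi>) \<subseteq> F (a, \<xi>)" using fixed F_eq by auto
  then have ex: "\<exists>!f. f \<in> Hom C a c \<and> Comp D (fob \<iota> a) (fob \<iota> c) u \<chi> (far \<iota> a c f) = \<xi>"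
    using F_factor[OF c _] a \<xi> by (simp add: slice_Ob slice_Hom)
  have c': "c \<in> Ob C" using c by (simp add: slice_Ob)
  then have bij: "far \<iota> a c ` Hom C a c = Hom D (fob \<iota> a) (fob \<iota> c)"
    using \<iota> a unfolding full_embedding_def bij_betw_def by simp
  show ?thesis
  proof (rule ex_ex1I)
    show "\<exists>h. h \<in> Hom D (fob \<iota> a) (fob \<iota> c) \<and> Comp D (fob \<iota> a) (fob \<iota> c) u \<chi> h = \<xi>"
      using ex bij by blast
    fix h h' assume "h \<in> Hom D (fob \<iota> a) (fob \<iota> c) \<and> Comp D (fob \<iota> a) (fob \<iota> c) u \<chi> h = \<xi>"
      "h' \<in> Hom D (fob \<iota> a) (fob \<iota> c) \<and> Comp D (fob \<iota> a) (fob \<iota> c) u \<chi> h' = \<xi>"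
    moreover from this obtain f f' where "f \<in> Hom C a c" "f' \<in> Hom C a c" "far \<iota> a c f = h" "far \<iota> a c f' = h'"
      using bij by (metis imageE)
    ultimately show "h = h'" using ex by blast
  qed
qed

end

theorem theorem4p19:
  fixes C :: "('o, 'v) cat" and D :: "('p, 'v) cat"
    and \<iota> :: "('o, 'v, 'p, 'v) cfunctor" and u :: 'p and T :: "'v topology"
  assumes "atomically_complete C"
    and "category D"
    and "full_embedding C D \<iota>"
    and "universal_for C D \<iota> u"
    and "ultrahomogeneous_for C D \<iota> u"
    and "algebraic_base (aut_group D u)
           {fixing_subgroup D u (fob \<iota> d) \<chi> | d \<chi>. d \<in> Ob C \<and> \<chi> \<in> Hom D (fob \<iota> d) u}"
    and "topological_group (aut_group D u) T"
    and "neighbourhood_basis T \<one>\<^bsub>aut_group D u\<^esub>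
           {fixing_subgroup D u (fob \<iota> d) \<chi> | d \<chi>. d \<in> Ob C \<and> \<chi> \<in> Hom D (fob \<iota> d) u}"
    and "induces_equivalence (op_cat C) (atomic_topology (op_cat C))
           (cont_cat (aut_group D u) T) (hom_action_functor D \<iota> u)"
  shows "is_functor (op_cat (slice_cat C D \<iota> u)) (subgroup_cat (aut_group D u))
           (fixing_functor D \<iota> u) \<and>
    (\<forall>p q. isomorphic_in (slice_cat C D \<iota> u) p q \<longrightarrow>
           fob (fixing_functor D \<iota> u) p = fob (fixing_functor D \<iota> u) q) \<and>
    bij_betw (on_classes (fob (fixing_functor D \<iota> u)))
           (Ob (slice_cat C D \<iota> u) // iso_rel (slice_cat C D \<iota> u))
           {U. subgroup U (aut_group D u) \<and> openin T U} \<and>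
    (\<forall>U c\<^sub>U \<chi>\<^sub>U. subgroup U (aut_group D u) \<and> openin T U \<and>
           (c\<^sub>U, \<chi>\<^sub>U) \<in> Ob (slice_cat C D \<iota> u) \<and>
           fob (fixing_functor D \<iota> u) (c\<^sub>U, \<chi>\<^sub>U) = U \<longrightarrow>
             (\<forall>f\<in>U. Comp D (fob \<iota> c\<^sub>U) u u f \<chi>\<^sub>U = \<chi>\<^sub>U) \<and>
             (\<forall>a\<in>Ob C. \<forall>\<xi>\<in>Hom D (fob \<iota> a) u.
                (\<forall>f\<in>U. Comp D (fob \<iota> a) u u f \<xi> = \<xi>) \<longrightarrow>
                (\<exists>!h. h \<in> Hom D (fob \<iota> a) (fob \<iota> c\<^sub>U) \<and>
                      Comp D (fob \<iota> a) (fob \<iota> c\<^sub>U) u \<chi>\<^sub>U h = \<xi>)))"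
proof -
  interpret Homogeneous_Equivalence C D \<iota> u T
    by unfold_locales (fact assms)+
  show ?thesis
  proof (intro conjI allI impI ballI F_functor F_bij)
    show "F p = F q" if "isomorphic_in (slice_cat C D \<iota> u) p q" for p q
      using that isomorphic_slice_iff by blast
    fix U c\<^sub>U \<chi>\<^sub>U
    assume U: "subgroup U G \<and> openin T U \<and> (c\<^sub>U, \<chi>\<^sub>U) \<in> Ob (slice_cat C D \<iota> u) \<and> F (c\<^sub>U, \<chi>\<^sub>U) = U"
    show "Comp D (fob \<iota> c\<^sub>U) u u f \<chi>\<^sub>U = \<chi>\<^sub>U" if "f \<in> U" for f
      using U that F_eq by blast
    show "\<exists>!h. h \<in> Hom D (fob \<iota> a) (fob \<iota> c\<^sub>U) \<and> Comp D (fob \<iota> a) (fob \<iota> c\<^sub>U) u \<chi>\<^sub>U h = \<xi>"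
      if "a \<in> Ob C" "\<xi> \<in> Hom D (fob \<iota> a) u" "\<forall>f\<in>U. Comp D (fob \<iota> a) u u f \<xi> = \<xi>" for a \<xi>
      using F_universal[of c\<^sub>U \<chi>\<^sub>U a \<xi>] U that by blast
  qed
qed

end
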